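(* Let $n,m\in\mathbb{N}$ and let $S:C(K_n)\to C(K_m)$ be a weakly compact operator. Then for each integer $j\ge 1$ the set $$\Gamma(S,j)=\{t\in L_n:\ \exists x\in\tau_n^{-1}(\{t\})\ \ |S^*(\delta_{i_{m,n}(x)})(\tau_n^{-1}(\{t\}))|>1/j\}$$ is finite.
   Context: All Banach spaces are real, operators are bounded and linear, $\mathbb{N}=\{0,1,2,\dots\}$, and $C(K)$ carries the supremum norm. For a Boolean algebra $A$, $S(A)$ is its Stone space; $A$ is identified with the algebra of clopen subsets of $S(A)$. Elements of $C(K_n)^*$ are identified with Radon measures on $K_n$; $\delta_y$ is the point mass (evaluation) at $y$, and $S^*$ is the adjoint of the operator $S$. Fixed objects. $A$ is an infinite Boolean algebra whose Stone space $K$ is the union of disjoint clopen sets $K_{1,*},K_{2,*}$ such that: (1) $K$ is separable and perfect (no isolated points); (2) every operator on $C(K)$ is of the form $T=f\,\mathrm{Id}+S$ with $f\in C(K)$ and $S$ weakly compact; (3) $C(K)$ contains no isomorphic copy of $\ell_\infty$; (4) there is a dense subalgebra $B\subseteq A$ (every nonzero element of $A$ contains a nonzero element of $B$) with $K_{1,*},K_{2,*}\in B$ and an automorphism $j:B\to B$ with $j(K_{3-i,*})=K_{i,*}$ for $i=1,2$ and $j^2=\mathrm{Id}_B$ (this $j$ is unrelated to the integer $j$ in the claim); (5) for every sequence $(a_n)$ of pairwise disjoint clopen subsets of $K$ there is an infinite $M\subseteq\mathbb{N}$ such that $\sup_{n\in M}a_n$ exists in $A$. Let $C=\{b\in B: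 j(b)=b\}$, $L=S(C)$, and let $\tau:K\to L$, $\tau(u)=u\cap C$, be the canonical surjection. For each $n\in\mathbb{N}$ let $A_n,B_n,C_n,K_n,L_n,\tau_n:K_n\to L_n$ be copies of $A,B,C,K,L,\tau$, with the $K_n$ pairwise disjoint, and let $i_{m,n}:K_n\to K_m$ be the canonical homeomorphisms between copies. *)

theory Defs
  imports "HOL-Analysis.Analysis" "HOL-Library.Phantom_Type" "HOL-Library.Infinite_Typeclass"
begin

section \<open>Boolean algebras and their Stone spaces\<close>

definition boolean_subalgebra :: "'a::boolean_algebra set \<Rightarrow> bool" where
  "boolean_subalgebra D \<longleftrightarrow> bot \<in> D \<and> top \<in> D \<and> (\<forall>a\<in>D. - a \<in> D) \<and>
     (\<forall>a\<in>D. \<forall>b\<in>D. inf a b \<in> D) \<and> (\<forall>a\<in>D. \<forall>b\<in>D. sup a b \<in> D)"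

definition dense_subalgebra :: "'a::boolean_algebra set \<Rightarrow> bool" where
  "dense_subalgebra D \<longleftrightarrow> boolean_subalgebra D \<and>
     (\<forall>a. a \<noteq> bot \<longrightarrow> (\<exists>d\<in>D. d \<noteq> bot \<and> d \<le> a))"

definition boolean_automorphism :: "'a::boolean_algebra set \<Rightarrow> ('a \<Rightarrow> 'a) \<Rightarrow> bool" where
  "boolean_automorphism D h \<longleftrightarrow> bij_betw h D D \<and> (\<forall>a\<in>D. h (- a) = - h a) \<and>
     (\<forall>a\<in>D. \<forall>b\<in>D. h (inf a b) = inf (h a) (h b)) \<and>
     (\<forall>a\<in>D. \<forall>b\<in>D. h (sup a b) = sup (h a) (h b))"

text \<open>The points of the Stone space of a subalgebra \<open>D\<close>: its ultrafilters.\<close>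

definition ultrafilters :: "'a::boolean_algebra set \<Rightarrow> 'a set set" where
  "ultrafilters D = {u. u \<subseteq> D \<and> top \<in> u \<and> bot \<notin> u \<and>
     (\<forall>a\<in>u. \<forall>b\<in>u. inf a b \<in> u) \<and> (\<forall>a\<in>u. \<forall>b\<in>D. a \<le> b \<longrightarrow> b \<in> u) \<and>
     (\<forall>a\<in>D. a \<in> u \<or> - a \<in> u)}"

definition proper_filter :: "'a::boolean_algebra set \<Rightarrow> bool" where
  "proper_filter F \<longleftrightarrow> top \<in> F \<and> bot \<notin> F \<and>
     (\<forall>a\<in>F. \<forall>b\<in>F. inf a b \<in> F) \<and> (\<forall>a\<in>F. \<forall>b. a \<le> b \<longrightarrow> b \<in> F)"

lemma proper_filter_extends:
  assumes F: "proper_filter F"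
  shows "\<exists>u\<in>ultrafilters UNIV. F \<subseteq> u"
proof -
  let ?P = "{G. proper_filter G \<and> F \<subseteq> G}"
  have "\<exists>M\<in>?P. \<forall>G\<in>?P. M \<subseteq> G \<longrightarrow> G = M"
  proof (rule subset_Zorn_nonempty)
    show "?P \<noteq> {}" using F by blast
  next
    fix \<C> assume ne: "\<C> \<noteq> {}" and ch: "subset.chain ?P \<C>"
    have sub: "\<And>G. G \<in> \<C> \<Longrightarrow> proper_filter G \<and> F \<subseteq> G"
      using ch by (auto simp: subset.chain_def)
    have lin: "\<And>G H. G \<in> \<C> \<Longrightarrow> H \<in> \<C> \<Longrightarrow> G \<subseteq> H \<or> H \<subseteq> G"
      using ch unfolding subset.chain_def by blast
    have "inf a b \<in> \<Union>\<C>" if "a \<in> \<Union>\<C>" "b \<in> \<Union>\<C>" for a b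
    proof -
      from that obtain G H where GH: "G \<in> \<C>" "H \<in> \<C>" "a \<in> G" "b \<in> H" by blast
      then obtain I where "I \<in> \<C>" "a \<in> I" "b \<in> I" using lin[of G H] by blast
      then show ?thesis using sub[of I] by (auto simp: proper_filter_def)
    qed
    moreover have "top \<in> \<Union>\<C>" "bot \<notin> \<Union>\<C>"
      using ne sub by (auto simp: proper_filter_def)
    moreover have "b \<in> \<Union>\<C>" if "a \<in> \<Union>\<C>" "a \<le> b" for a b
      using that sub unfolding proper_filter_def by blast
    ultimately have "proper_filter (\<Union>\<C>)"
      unfolding proper_filter_def by blast
    then show "\<Union>\<C> \<in> ?P" using ne sub by blast
  qed
  then obtain M where M': "M \<in> ?P" "\<forall>G\<in>?P. M \<subseteq> G \<longrightarrow> G = M" by (elim bexE)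
  then have M: "proper_filter M" "F \<subseteq> M" by simp_all
  have max: "G = M" if "proper_filter G" "M \<subseteq> G" for G
    using M'(2) M(2) that by (simp add: order_trans)
  have "a \<in> M \<or> - a \<in> M" for a
  proof (rule ccontr)
    assume n: "\<not> (a \<in> M \<or> - a \<in> M)"
    let ?G = "{x. \<exists>m\<in>M. inf m a \<le> x}"
    have "bot \<notin> ?G"
    proof
      assume "bot \<in> ?G"
      then obtain m where m: "m \<in> M" "inf m a = bot" by (auto simp: bot_unique)
      then have "m \<le> - a" by (simp add: inf_shunt)
      then show False using n m M(1) unfolding proper_filter_def by blast
    qed
    moreover have "top \<in> ?G" using M(1) by (auto simp: proper_filter_def)
    moreover have "inf x y \<in> ?G" if x: "x \<in> ?G" and y: "y \<in> ?G" for x y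
    proof -
      from x y obtain m k where mk: "m \<in> M" "k \<in> M" "inf m a \<le> x" "inf k a \<le> y" by blast
      have "inf m k \<in> M" using mk M(1) by (auto simp: proper_filter_def)
      moreover have "inf (inf m k) a \<le> inf x y"
        using mk(3,4) by (meson inf.bounded_iff inf.cobounded1 inf.cobounded2 order_trans)
      ultimately show ?thesis by blast
    qed
    moreover have "y \<in> ?G" if "x \<in> ?G" "x \<le> y" for x y
      using that by (auto intro: order_trans)
    ultimately have "proper_filter ?G"
      unfolding proper_filter_def by (intro conjI ballI allI impI)
    moreover have "M \<subseteq> ?G" by (auto intro: inf.coboundedI1)
    ultimately have "?G = M" using max by blast
    moreover have "a \<in> ?G" using M(1) by (auto simp: proper_filter_def)
    ultimately show False using n by blast
  qed
  then have "M \<in> ultrafilters UNIV"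
    using M(1) unfolding ultrafilters_def proper_filter_def by auto
  then show ?thesis using M(2) by blast
qed

lemma ultrafilter_exists:
  assumes "(a::'a::boolean_algebra) \<noteq> bot"
  shows "\<exists>u\<in>ultrafilters UNIV. a \<in> u"
proof -
  have "proper_filter {x. a \<le> x}"
    using assms by (auto simp: proper_filter_def bot_unique intro: order_trans)
  from proper_filter_extends[OF this] show ?thesis by blast
qed

text \<open>The sort \<open>infinite\<close> carries the hypothesis that the algebra is infinite; in particular the
  algebra is not degenerate, so that its Stone space is nonempty.\<close>

typedef (overloaded) 'a stone = "ultrafilters (UNIV :: 'a::{boolean_algebra, infinite} set)"
  morphisms ultra_of Abs_stone
proof -
  have "\<exists>a::'a. a \<noteq> bot"
    using arb_element[of "{bot::'a}"] by auto
  then show "\<exists>u. u \<in> ultrafilters (UNIV :: 'a set)" using ultrafilter_exists by blast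
qed

text \<open>The clopen set identified with the element \<open>a\<close>.\<close>

definition clopen_of :: "'a::{boolean_algebra, infinite} \<Rightarrow> 'a stone set" where
  "clopen_of a = {x. a \<in> ultra_of x}"

lemma clopen_of_top [simp]: "clopen_of top = UNIV"
  and clopen_of_bot [simp]: "clopen_of bot = {}"
  using ultra_of by (auto simp: clopen_of_def ultrafilters_def)

lemma clopen_of_inf: "clopen_of (inf a b) = clopen_of a \<inter> clopen_of b"
proof -
  have "inf a b \<in> ultra_of x \<longleftrightarrow> a \<in> ultra_of x \<and> b \<in> ultra_of x" for x :: "'a stone"
  proof -
    have u: "ultra_of x \<in> ultrafilters UNIV" by (rule ultra_of)
    then have "inf a b \<in> ultra_of x" if "a \<in> ultra_of x" "b \<in> ultra_of x"
      using that by (simp add: ultrafilters_def)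
    moreover have up: "d \<in> ultra_of x" if "c \<in> ultra_of x" "c \<le> d" for c d
      using u that unfolding ultrafilters_def by blast
    ultimately show ?thesis by (meson inf.cobounded1 inf.cobounded2)
  qed
  then show ?thesis by (auto simp: clopen_of_def)
qed

lemma clopen_of_uminus: "clopen_of (- a) = - clopen_of a"
proof -
  have "- a \<in> ultra_of x \<longleftrightarrow> a \<notin> ultra_of x" for x :: "'a stone"
  proof -
    have u: "ultra_of x \<in> ultrafilters UNIV" by (rule ultra_of)
    then have "\<not> (a \<in> ultra_of x \<and> - a \<in> ultra_of x)"
      unfolding ultrafilters_def by (metis (mono_tags, lifting) inf_compl_bot mem_Collect_eq)
    moreover have "a \<in> ultra_of x \<or> - a \<in> ultra_of x" using u by (auto simp: ultrafilters_def)
    ultimately show ?thesis by blast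
  qed
  then show ?thesis by (auto simp: clopen_of_def)
qed

lemma clopen_of_sup: "clopen_of (sup a b) = clopen_of a \<union> clopen_of b"
proof -
  have "sup a b = - inf (- a) (- b)" by simp
  then show ?thesis by (simp only: clopen_of_inf clopen_of_uminus) auto
qed

lemma clopen_of_subset_iff: "clopen_of a \<subseteq> clopen_of b \<longleftrightarrow> a \<le> b"
proof
  assume s: "clopen_of a \<subseteq> clopen_of b"
  show "a \<le> b"
  proof (rule ccontr)
    assume "\<not> a \<le> b"
    then have "inf a (- b) \<noteq> bot" using inf_shunt[of a "- b"] by simp
    then obtain u where u: "u \<in> ultrafilters UNIV" "inf a (- b) \<in> u"
      using ultrafilter_exists by blast
    then have "Abs_stone u \<in> clopen_of (inf a (- b))"
      by (simp add: clopen_of_def Abs_stone_inverse)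
    then show False using s by (auto simp: clopen_of_inf clopen_of_uminus)
  qed
next
  assume "a \<le> b"
  then have "clopen_of a = clopen_of a \<inter> clopen_of b"
    by (metis clopen_of_inf inf.absorb1)
  then show "clopen_of a \<subseteq> clopen_of b" by blast
qed

instantiation stone :: ("{boolean_algebra, infinite}") t2_space
begin

definition open_stone :: "'a stone set \<Rightarrow> bool" where
  "open_stone U \<longleftrightarrow> (\<forall>x\<in>U. \<exists>a. x \<in> clopen_of a \<and> clopen_of a \<subseteq> U)"

instance
proof
  show "open (UNIV :: 'a stone set)"
    unfolding open_stone_def by (metis UNIV_I clopen_of_top subset_UNIV)
next
  fix S T :: "'a stone set" assume ST: "open S" "open T"
  show "open (S \<inter> T)" unfolding open_stone_def
  proof
    fix x assume "x \<in> S \<inter> T"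
    then obtain a b where "x \<in> clopen_of a" "clopen_of a \<subseteq> S" "x \<in> clopen_of b" "clopen_of b \<subseteq> T"
      using ST unfolding open_stone_def by blast
    then show "\<exists>c. x \<in> clopen_of c \<and> clopen_of c \<subseteq> S \<inter> T"
      by (intro exI[of _ "inf a b"]) (auto simp: clopen_of_inf)
  qed
next
  fix \<U> :: "'a stone set set" assume "\<forall>S\<in>\<U>. open S"
  then show "open (\<Union>\<U>)" unfolding open_stone_def by (meson Union_iff Union_upper order_trans)
next
  fix x y :: "'a stone" assume "x \<noteq> y"
  then obtain a where "a \<in> ultra_of x \<and> a \<notin> ultra_of y \<or> a \<in> ultra_of y \<and> a \<notin> ultra_of x"
    using ultra_of_inject[of x y] by blast
  then obtain a where a: "a \<in> ultra_of x" "a \<notin> ultra_of y"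
    using clopen_of_uminus[of a] by (auto simp: clopen_of_def)
  have "open (clopen_of c)" for c :: 'a unfolding open_stone_def by blast
  moreover have "x \<in> clopen_of a" "y \<in> clopen_of (- a)"
    using a by (simp_all add: clopen_of_uminus) (simp_all add: clopen_of_def)
  moreover have "clopen_of a \<inter> clopen_of (- a) = {}" by (simp add: clopen_of_uminus)
  ultimately show "\<exists>U V. open U \<and> open V \<and> x \<in> U \<and> y \<in> V \<and> U \<inter> V = {}" by blast
qed

end

text \<open>Compactness means that every continuous real function on the Stone space is bounded, so
  that the library type of bounded continuous functions is \<open>C(K)\<close> with the supremum norm.\<close>

lemma compact_UNIV_stone: "compact (UNIV :: 'a::{boolean_algebra, infinite} stone set)"
proof (rule compactI)
  fix \<U> :: "'a stone set set"
  assume op: "\<forall>U\<in>\<U>. open U" and cov: "UNIV \<subseteq> \<Union>\<U>"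
  show "\<exists>\<V>\<subseteq>\<U>. finite \<V> \<and> UNIV \<subseteq> \<Union>\<V>"
  proof (rule ccontr)
    assume n: "\<not> (\<exists>\<V>\<subseteq>\<U>. finite \<V> \<and> UNIV \<subseteq> \<Union>\<V>)"
    let ?F = "{a. \<exists>\<V>\<subseteq>\<U>. finite \<V> \<and> clopen_of a \<union> \<Union>\<V> = UNIV}"
    have "inf a b \<in> ?F" if a: "a \<in> ?F" and b: "b \<in> ?F" for a b
    proof -
      from a obtain \<V> where V: "\<V> \<subseteq> \<U>" "finite \<V>" "clopen_of a \<union> \<Union>\<V> = UNIV" by auto
      from b obtain \<W> where W: "\<W> \<subseteq> \<U>" "finite \<W>" "clopen_of b \<union> \<Union>\<W> = UNIV" by auto
      have "clopen_of (inf a b) \<union> \<Union>(\<V> \<union> \<W>) = UNIV"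
        using V(3) W(3) by (auto simp: clopen_of_inf)
      then show ?thesis using V W by (intro CollectI exI[of _ "\<V> \<union> \<W>"]) auto
    qed
    moreover have "b \<in> ?F" if a: "a \<in> ?F" and le: "a \<le> b" for a b
    proof -
      from a obtain \<V> where V: "\<V> \<subseteq> \<U>" "finite \<V>" "clopen_of a \<union> \<Union>\<V> = UNIV" by auto
      have "clopen_of b \<union> \<Union>\<V> = UNIV" using V(3) le clopen_of_subset_iff[of a b] by blast
      then show ?thesis using V by blast
    qed
    moreover have "bot \<notin> ?F" using n by auto
    moreover have "top \<in> ?F" by (auto intro: exI[of _ "{}"])
    ultimately have "proper_filter ?F"
      unfolding proper_filter_def by (intro conjI ballI allI impI)
    then obtain u where u: "u \<in> ultrafilters UNIV" "?F \<subseteq> u"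
      using proper_filter_extends by blast
    define x where "x = Abs_stone u"
    have ux: "ultra_of x = u" using u(1) by (simp add: x_def Abs_stone_inverse)
    obtain U where U: "U \<in> \<U>" "x \<in> U" using cov by blast
    then obtain a where a: "x \<in> clopen_of a" "clopen_of a \<subseteq> U"
      using op unfolding open_stone_def by blast
    have "- a \<in> ?F" using U a(2)
      by (intro CollectI exI[of _ "{U}"]) (auto simp: clopen_of_uminus)
    then have "x \<in> clopen_of (- a)" using u(2) ux by (auto simp: clopen_of_def)
    then show False using a(1) by (auto simp: clopen_of_uminus)
  qed
qed

text \<open>The identification of the algebra with the clopen subsets of its Stone space.\<close>

lemma bij_betw_clopen_of:
  "bij_betw clopen_of (UNIV :: 'a::{boolean_algebra, infinite} set) {U. open U \<and> closed U}"
  unfolding bij_betw_def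
proof
  show "inj (clopen_of :: 'a \<Rightarrow> _)"
    by (rule injI) (metis clopen_of_subset_iff order_antisym order_refl)
  have op: "open (clopen_of c)" for c :: 'a unfolding open_stone_def by blast
  have "closed (clopen_of c)" for c :: 'a
    using op[of "- c"] by (simp add: clopen_of_uminus closed_def)
  moreover have "U \<in> range clopen_of" if U: "open U" "closed U" for U :: "'a stone set"
  proof -
    have "compact U" using compact_Int_closed[OF compact_UNIV_stone U(2)] by simp
    moreover have "U \<subseteq> (\<Union>a\<in>{a. clopen_of a \<subseteq> U}. clopen_of a)"
      using U(1) unfolding open_stone_def by blast
    ultimately obtain T where T: "T \<subseteq> {a. clopen_of a \<subseteq> U}" "finite T"
      "U \<subseteq> (\<Union>a\<in>T. clopen_of a)"
      using op by (metis compactE_image)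
    have "\<exists>c. clopen_of c = (\<Union>a\<in>T. clopen_of a)" using T(2)
    proof induction
      case empty
      then show ?case by (auto intro: exI[of _ bot])
    next
      case (insert a T)
      then show ?case by (metis UN_insert clopen_of_sup)
    qed
    moreover have "(\<Union>a\<in>T. clopen_of a) = U" using T by blast
    ultimately show ?thesis by blast
  qed
  ultimately show "range (clopen_of :: 'a \<Rightarrow> _) = {U. open U \<and> closed U}"
    using op by (intro equalityI subsetI) auto
qed

section \<open>Copies\<close>

text \<open>The copies are tagged by a phantom type parameter in the role of the index: the \<open>n\<close>-th copy
  of a space of type \<open>'b\<close> has type \<open>('n, 'b) phantom\<close>. Copies with different tags are different
  types, hence disjoint, and a statement about arbitrary tags \<open>'n\<close> and \<open>'m\<close> covers the case of
  equal tags as well.\<close>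

instantiation phantom :: (type, topological_space) topological_space
begin

definition open_phantom :: "('a, 'b) phantom set \<Rightarrow> bool" where
  "open_phantom U \<longleftrightarrow> open (phantom -` U)"

instance
proof
  show "open (UNIV :: ('a, 'b) phantom set)" by (simp add: open_phantom_def)
  show "open (S \<inter> T)" if "open S" "open T" for S T :: "('a, 'b) phantom set"
    using that by (auto simp: open_phantom_def vimage_Int)
  show "open (\<Union>\<U>)" if "\<forall>S\<in>\<U>. open S" for \<U> :: "('a, 'b) phantom set set"
    using that by (auto simp: open_phantom_def vimage_Union)
qed

end

text \<open>The canonical homeomorphism \<open>i\<^sub>m\<^sub>,\<^sub>n\<close> from the \<open>n\<close>-th to the \<open>m\<close>-th copy.\<close>

definition copy_map :: "('n, 'b) phantom \<Rightarrow> ('m, 'b) phantom" where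
  "copy_map x = phantom (of_phantom x)"

definition tau :: "'a::{boolean_algebra, infinite} set \<Rightarrow> 'a stone \<Rightarrow> 'a set" where
  "tau C u = ultra_of u \<inter> C"

definition tau_copy ::
  "'a::{boolean_algebra, infinite} set \<Rightarrow> ('n, 'a stone) phantom \<Rightarrow> ('n, 'a set) phantom" where
  "tau_copy C x = phantom (tau C (of_phantom x))"

definition L_copy :: "'a::boolean_algebra set \<Rightarrow> ('n, 'a set) phantom set" where
  "L_copy C = phantom ` ultrafilters C"

section \<open>Banach space notions\<close>

definition weak_topology :: "'x::real_normed_vector topology" where
  "weak_topology = topology_generated_by
     {blinfun_apply \<phi> -` U |(\<phi> :: 'x \<Rightarrow>\<^sub>L real) U. open U}"

text \<open>The image of the closed unit ball is relatively weakly compact.\<close>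

definition weakly_compact_operator ::
  "('x::real_normed_vector \<Rightarrow>\<^sub>L 'y::real_normed_vector) \<Rightarrow> bool" where
  "weakly_compact_operator T \<longleftrightarrow>
     compactin weak_topology (weak_topology closure_of (blinfun_apply T ` cball 0 1))"

definition isomorphic_embedding ::
  "('x::real_normed_vector \<Rightarrow>\<^sub>L 'y::real_normed_vector) \<Rightarrow> bool" where
  "isomorphic_embedding J \<longleftrightarrow>
     (\<exists>g. homeomorphism UNIV (range (blinfun_apply J)) (blinfun_apply J) g)"

definition adjoint_operator ::
  "('x::real_normed_vector \<Rightarrow>\<^sub>L 'y::real_normed_vector) \<Rightarrow> ('y \<Rightarrow>\<^sub>L real) \<Rightarrow> ('x \<Rightarrow>\<^sub>L real)" where
  "adjoint_operator S \<psi> = \<psi> o\<^sub>L S"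

lift_definition point_mass :: "'k::topological_space \<Rightarrow> (('k \<Rightarrow>\<^sub>C real) \<Rightarrow>\<^sub>L real)" is
  "\<lambda>y f. apply_bcontfun f y"
  by (rule bounded_linear_intro[where K = 1]) (auto intro: norm_bounded[where 'b = real, simplified])

text \<open>Finite positive Radon measures on a compact Hausdorff space.\<close>

definition radon_measure :: "'k::topological_space measure \<Rightarrow> bool" where
  "radon_measure M \<longleftrightarrow> sets M = sets borel \<and> finite_measure M \<and>
     (\<forall>E\<in>sets borel. emeasure M E = (SUP F\<in>{F. compact F \<and> F \<subseteq> E}. emeasure M F))"

text \<open>The signed Radon measure, as a set function, identified with a functional on \<open>C(K)\<close> for
  compact Hausdorff \<open>K\<close>. Signed Radon measures are the differences of two finite positive ones;
  the value is \<open>0\<close> on sets that are not Borel.\<close>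

definition riesz_measure :: "(('k::topological_space \<Rightarrow>\<^sub>C real) \<Rightarrow>\<^sub>L real) \<Rightarrow> 'k set \<Rightarrow> real" where
  "riesz_measure \<phi> = (THE \<mu>. \<exists>M N. radon_measure M \<and> radon_measure N \<and>
     (\<forall>f. blinfun_apply \<phi> f
            = integral\<^sup>L M (apply_bcontfun f) - integral\<^sup>L N (apply_bcontfun f)) \<and>
     \<mu> = (\<lambda>E. measure M E - measure N E))"

section \<open>The set \<open>\<Gamma>(S, j)\<close>\<close>

definition Gamma_set :: "'a::{boolean_algebra, infinite} set \<Rightarrow>
    ((('n, 'a stone) phantom \<Rightarrow>\<^sub>C real) \<Rightarrow>\<^sub>L (('m, 'a stone) phantom \<Rightarrow>\<^sub>C real)) \<Rightarrow>
    nat \<Rightarrow> ('n, 'a set) phantom set" where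
  "Gamma_set C S j = {t \<in> L_copy C. \<exists>x\<in>tau_copy C -` {t}.
     \<bar>riesz_measure (adjoint_operator S (point_mass (copy_map x))) (tau_copy C -` {t})\<bar> > 1 / real j}"

end

theory Submission
  imports Defs
begin

text \<open>Suppose that \<open>\<Gamma>(S, j)\<close> is infinite. It contains a sequence of points \<open>t\<^sub>k\<close> that have pairwise
  disjoint clopen neighbourhoods \<open>c\<^sub>k\<close> in \<open>L\<close> (\<open>infinite_ultrafilters_disjoint_members\<close>). The fibre
  over \<open>t\<^sub>k\<close> is a closed subset of the clopen set in \<open>K\<close> given by \<open>c\<^sub>k\<close>, and its measure under some
  \<open>S\<^sup>* \<delta>\<close> exceeds \<open>1/j\<close> in absolute value. By regularity it can be enlarged to a clopen set \<open>V\<^sub>k\<close>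
  below \<open>c\<^sub>k\<close> whose measure still does (\<open>riesz_measure_approx_clopen\<close>). The measure of \<open>V\<^sub>k\<close> is a
  value of \<open>S\<close> applied to the indicator of \<open>V\<^sub>k\<close>, so these images all have norm above \<open>1/j\<close>. The
  indicators are disjoint functions of norm at most \<open>1\<close>, and a weakly compact operator sends such a
  sequence to a null sequence (\<open>weakly_compact_disjoint_tendsto_0\<close>), a contradiction.

  The last fact is proved by a gliding hump (\<open>gliding_hump\<close>), which makes the images of the
  indicators almost disjoint along a sequence of points, and an exchange of limits between partial
  sums of indicators and these points (\<open>weakly_compact_no_staircase\<close>).

  Talking about the measure \<open>S\<^sup>* \<delta>\<close> at all requires the Riesz representation theorem for the spaces
  at hand: \<open>riesz_measure\<close> is given by a definite description, which is meaningful only if a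
  representing measure exists (\<open>radon_representation\<close>) and is unique (\<open>radon_differences_eqI\<close>).
  Zero-dimensionality makes this elementary, because a functional restricts to a finitely
  additive set function on clopen sets, whose positive and negative parts extend to Radon
  measures.\<close>

section \<open>Boolean spaces\<close>

text \<open>The class covers a Stone space and its copies alike. Its two axioms work together: every open
  set is a union of clopen sets, and finitely many of these suffice to cover a closed subset.\<close>

class boolean_space = t2_space +
  assumes boolean_space_compact: "compact UNIV"
    and clopen_basis: "open U \<Longrightarrow> x \<in> U \<Longrightarrow> \<exists>V. (open V \<and> closed V) \<and> x \<in> V \<and> V \<subseteq> U"

abbreviation clopen :: "'k::topological_space set \<Rightarrow> bool" where
  "clopen V \<equiv> open V \<and> closed V"

lemma clopen_clopen_of: "clopen (clopen_of a)"
  using bij_betwE[OF bij_betw_clopen_of, rule_format, of a] by simp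

instance stone :: ("{boolean_algebra, infinite}") boolean_space
proof
  show "compact (UNIV :: 'a stone set)"
    by (rule compact_UNIV_stone)
  show "\<exists>V. clopen V \<and> x \<in> V \<and> V \<subseteq> U" if "open U" "x \<in> U" for U :: "'a stone set" and x
  proof -
    obtain a where "x \<in> clopen_of a" "clopen_of a \<subseteq> U"
      using \<open>open U\<close> \<open>x \<in> U\<close> unfolding open_stone_def by (elim ballE exE) auto
    then show ?thesis
      using clopen_clopen_of by (intro exI[of _ "clopen_of a"]) simp
  qed
qed

lemma closed_phantom_iff: "closed F \<longleftrightarrow> closed (phantom -` F)"
  by (simp add: closed_def open_phantom_def vimage_Compl)

lemma open_of_phantom_vimage: "open U \<Longrightarrow> open (of_phantom -` U)"
  by (simp add: open_phantom_def vimage_def)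

lemma closed_of_phantom_vimage: "closed F \<Longrightarrow> closed (of_phantom -` F)"
  by (simp add: closed_phantom_iff vimage_def)

lemma continuous_on_phantom: "continuous_on UNIV phantom"
  by (subst continuous_on_open_vimage) (auto simp: open_phantom_def)

instance phantom :: (type, boolean_space) boolean_space
proof
  fix x y :: "('a, 'b) phantom"
  assume "x \<noteq> y"
  show "\<exists>U V. open U \<and> open V \<and> x \<in> U \<and> y \<in> V \<and> U \<inter> V = {}"
  proof -
    have "of_phantom x \<noteq> of_phantom y"
      using \<open>x \<noteq> y\<close> by (metis phantom.collapse)
    then obtain U V where "open U" "open V" "of_phantom x \<in> U" "of_phantom y \<in> V" "U \<inter> V = {}"
      by (meson hausdorff)
    then show ?thesis
      by (intro exI[of _ "of_phantom -` U"] exI[of _ "of_phantom -` V"])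
        (auto intro: open_of_phantom_vimage)
  qed
next
  have "compact (range (phantom :: 'b \<Rightarrow> ('a, 'b) phantom))"
    by (rule compact_continuous_image[OF continuous_on_phantom boolean_space_compact])
  moreover have "range (phantom :: 'b \<Rightarrow> ('a, 'b) phantom) = UNIV"
    by (metis surjI phantom.collapse)
  ultimately show "compact (UNIV :: ('a, 'b) phantom set)"
    by simp
next
  show "\<exists>V. clopen V \<and> x \<in> V \<and> V \<subseteq> U" if "open U" "x \<in> U" for U :: "('a, 'b) phantom set" and x
  proof -
    have "open (phantom -` U)" "of_phantom x \<in> phantom -` U"
      using that by (auto simp: open_phantom_def)
    then obtain V where "clopen V" "of_phantom x \<in> V" "V \<subseteq> phantom -` U"
      using clopen_basis by blast
    then show ?thesis
      by (intro exI[of _ "of_phantom -` V"])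
        (force intro: open_of_phantom_vimage closed_of_phantom_vimage)
  qed
qed

lemma compact_if_closed:
  fixes F :: "'k::boolean_space set"
  shows "closed F \<Longrightarrow> compact F"
  using compact_Int_closed[OF boolean_space_compact] by simp

text \<open>A compact set is covered by finitely many of the clopen sets that make up an open set.\<close>

lemma clopen_between:
  fixes F :: "'k::boolean_space set"
  assumes F: "closed F" and U: "open U" and "F \<subseteq> U"
  obtains V where "clopen V" "F \<subseteq> V" "V \<subseteq> U"
proof -
  have "F \<subseteq> \<Union>{V. clopen V \<and> V \<subseteq> U}"
    using clopen_basis[OF U] \<open>F \<subseteq> U\<close> by blast
  then obtain T where T: "T \<subseteq> {V. clopen V \<and> V \<subseteq> U}" "finite T" "F \<subseteq> \<Union>T"
    by (rule compactE[OF compact_if_closed[OF F]]) auto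
  then have "clopen (\<Union>T)"
    by (auto intro!: closed_Union)
  then show ?thesis
    using T by (intro that) blast+
qed

section \<open>Regularity of Radon measures\<close>

lemma radon_sets: "radon_measure M \<Longrightarrow> sets M = sets borel"
  and radon_finite: "radon_measure M \<Longrightarrow> finite_measure M"
  by (auto simp: radon_measure_def)

text \<open>The approximation is stated for all Borel sets between \<open>F\<close> and \<open>E\<close>, not only for
  \<open>F\<close>, so that sets found for several measures can be joined into one that serves them all.\<close>

lemma radon_inner_regular:
  fixes E :: "'k::t2_space set"
  assumes M: "radon_measure M" and E: "E \<in> sets borel" and "e > 0"
  shows "\<exists>F. compact F \<and> F \<subseteq> E \<and>
    (\<forall>X\<in>sets borel. F \<subseteq> X \<longrightarrow> X \<subseteq> E \<longrightarrow> \<bar>measure M X - measure M E\<bar> < e)"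
proof -
  interpret finite_measure M using M by (rule radon_finite)
  have sets: "sets M = sets borel" using M by (rule radon_sets)
  have "\<exists>F. compact F \<and> F \<subseteq> E \<and> measure M E - e < measure M F"
  proof (cases "measure M E - e < 0")
    case True
    then show ?thesis by (intro exI[of _ "{}"]) auto
  next
    case False
    have "ennreal (measure M E - e) < emeasure M E"
      using \<open>e > 0\<close> False by (simp add: emeasure_eq_measure ennreal_less_iff)
    also have "emeasure M E = (SUP F\<in>{F. compact F \<and> F \<subseteq> E}. emeasure M F)"
      using M E by (auto simp: radon_measure_def)
    finally obtain F where "compact F" "F \<subseteq> E" "ennreal (measure M E - e) < emeasure M F"
      by (auto simp: less_SUP_iff)
    then show ?thesis
      using False by (auto simp: emeasure_eq_measure ennreal_less_iff)
  qed
  then obtain F where F: "compact F" "F \<subseteq> E" "measure M E - e < measure M F" by blast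
  have "\<bar>measure M X - measure M E\<bar> < e" if "X \<in> sets borel" "F \<subseteq> X" "X \<subseteq> E" for X
    using finite_measure_mono[of F X] finite_measure_mono[of X E] that F E sets
      compact_imp_closed[OF F(1)] by auto
  then show ?thesis using F(1,2) by blast
qed

text \<open>A compact set that almost exhausts the complement of \<open>F\<close> is disjoint from \<open>F\<close>, and
  \<open>clopen_between\<close> separates the two.\<close>

lemma radon_outer_regular:
  fixes F :: "'k::boolean_space set"
  assumes M: "radon_measure M" and F: "closed F" and "e > 0"
  shows "\<exists>V. clopen V \<and> F \<subseteq> V \<and>
    (\<forall>X\<in>sets borel. F \<subseteq> X \<longrightarrow> X \<subseteq> V \<longrightarrow> \<bar>measure M X - measure M F\<bar> < e)"
proof -
  interpret finite_measure M using M by (rule radon_finite)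
  have sets: "sets M = sets borel" using M by (rule radon_sets)
  have space: "space M = UNIV" using sets_eq_imp_space_eq[OF sets] by simp
  have compl: "measure M (- X) = measure M UNIV - measure M X" if "X \<in> sets borel" for X
    using finite_measure_compl[of X] that sets space by (simp add: Compl_eq_Diff_UNIV)
  obtain H where H: "compact H" "H \<subseteq> - F"
    "\<forall>X\<in>sets borel. H \<subseteq> X \<longrightarrow> X \<subseteq> - F \<longrightarrow> \<bar>measure M X - measure M (- F)\<bar> < e"
    using radon_inner_regular[OF M _ \<open>e > 0\<close>, of "- F"] F by auto
  obtain V where V: "clopen V" "F \<subseteq> V" "V \<subseteq> - H"
    by (rule clopen_between[OF F, of "- H"]) (use H compact_imp_closed[OF H(1)] in auto)
  have "\<bar>measure M X - measure M F\<bar> < e" if X: "X \<in> sets borel" "F \<subseteq> X" "X \<subseteq> V" for X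
  proof -
    have "\<bar>measure M (- X) - measure M (- F)\<bar> < e"
      using H(3)[rule_format, of "- X"] X V by auto
    moreover have "F \<in> sets borel" using F by simp
    ultimately show ?thesis using compl X by auto
  qed
  then show ?thesis using V(1,2) by blast
qed

text \<open>Clopen sets determine a signed Radon measure: a closed set is approximated from outside by
  a clopen set for all four positive measures at once, and a Borel set is approximated from
  inside by a closed one. On other sets all four values are \<open>0\<close>.\<close>

lemma radon_differences_eqI:
  fixes M1 N1 M2 N2 :: "'k::boolean_space measure"
  assumes radon: "radon_measure M1" "radon_measure N1" "radon_measure M2" "radon_measure N2"
    and eq: "\<And>V. clopen V \<Longrightarrow> measure M1 V - measure N1 V = measure M2 V - measure N2 V"
  shows "measure M1 E - measure N1 E = measure M2 E - measure N2 E"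
proof -
  have closed: "measure M1 F - measure N1 F = measure M2 F - measure N2 F" if F: "closed F" for F
  proof (rule ccontr)
    assume ne: "\<not> ?thesis"
    define e where "e = \<bar>(measure M1 F - measure N1 F) - (measure M2 F - measure N2 F)\<bar> / 4"
    have "e > 0" using ne by (simp add: e_def)
    obtain V1 where V1: "clopen V1" "F \<subseteq> V1"
      "\<forall>X\<in>sets borel. F \<subseteq> X \<longrightarrow> X \<subseteq> V1 \<longrightarrow> \<bar>measure M1 X - measure M1 F\<bar> < e"
      using radon_outer_regular[OF radon(1) F \<open>e > 0\<close>] by blast
    obtain V2 where V2: "clopen V2" "F \<subseteq> V2"
      "\<forall>X\<in>sets borel. F \<subseteq> X \<longrightarrow> X \<subseteq> V2 \<longrightarrow> \<bar>measure N1 X - measure N1 F\<bar> < e"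
      using radon_outer_regular[OF radon(2) F \<open>e > 0\<close>] by blast
    obtain V3 where V3: "clopen V3" "F \<subseteq> V3"
      "\<forall>X\<in>sets borel. F \<subseteq> X \<longrightarrow> X \<subseteq> V3 \<longrightarrow> \<bar>measure M2 X - measure M2 F\<bar> < e"
      using radon_outer_regular[OF radon(3) F \<open>e > 0\<close>] by blast
    obtain V4 where V4: "clopen V4" "F \<subseteq> V4"
      "\<forall>X\<in>sets borel. F \<subseteq> X \<longrightarrow> X \<subseteq> V4 \<longrightarrow> \<bar>measure N2 X - measure N2 F\<bar> < e"
      using radon_outer_regular[OF radon(4) F \<open>e > 0\<close>] by blast
    define V where "V = V1 \<inter> V2 \<inter> V3 \<inter> V4"
    have V: "clopen V" "F \<subseteq> V"
      using V1 V2 V3 V4 by (auto simp: V_def)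
    then have "V \<in> sets borel" by auto
    then have "\<bar>measure M1 V - measure M1 F\<bar> < e" "\<bar>measure N1 V - measure N1 F\<bar> < e"
      "\<bar>measure M2 V - measure M2 F\<bar> < e" "\<bar>measure N2 V - measure N2 F\<bar> < e"
      by (intro V1(3)[rule_format] V2(3)[rule_format] V3(3)[rule_format] V4(3)[rule_format] V; auto simp: V_def)+
    moreover have "4 * e = \<bar>(measure M1 F - measure N1 F) - (measure M2 F - measure N2 F)\<bar>"
      by (simp add: e_def)
    ultimately show False using eq[OF V(1)] by linarith
  qed
  show ?thesis
  proof (cases "E \<in> sets borel")
    case False
    then show ?thesis
      using radon[THEN radon_sets] by (simp add: measure_notin_sets)
  next
    case E: True
    show ?thesis
    proof (rule ccontr)
      assume ne: "\<not> ?thesis"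
      define e where "e = \<bar>(measure M1 E - measure N1 E) - (measure M2 E - measure N2 E)\<bar> / 4"
      have "e > 0" using ne by (simp add: e_def)
      obtain F1 where F1: "compact F1" "F1 \<subseteq> E"
        "\<forall>X\<in>sets borel. F1 \<subseteq> X \<longrightarrow> X \<subseteq> E \<longrightarrow> \<bar>measure M1 X - measure M1 E\<bar> < e"
        using radon_inner_regular[OF radon(1) E \<open>e > 0\<close>] by blast
      obtain F2 where F2: "compact F2" "F2 \<subseteq> E"
        "\<forall>X\<in>sets borel. F2 \<subseteq> X \<longrightarrow> X \<subseteq> E \<longrightarrow> \<bar>measure N1 X - measure N1 E\<bar> < e"
        using radon_inner_regular[OF radon(2) E \<open>e > 0\<close>] by blast
      obtain F3 where F3: "compact F3" "F3 \<subseteq> E"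
        "\<forall>X\<in>sets borel. F3 \<subseteq> X \<longrightarrow> X \<subseteq> E \<longrightarrow> \<bar>measure M2 X - measure M2 E\<bar> < e"
        using radon_inner_regular[OF radon(3) E \<open>e > 0\<close>] by blast
      obtain F4 where F4: "compact F4" "F4 \<subseteq> E"
        "\<forall>X\<in>sets borel. F4 \<subseteq> X \<longrightarrow> X \<subseteq> E \<longrightarrow> \<bar>measure N2 X - measure N2 E\<bar> < e"
        using radon_inner_regular[OF radon(4) E \<open>e > 0\<close>] by blast
      define F where "F = F1 \<union> F2 \<union> F3 \<union> F4"
      have F: "closed F" "F \<subseteq> E"
        using F1 F2 F3 F4 by (auto simp: F_def intro!: closed_Un compact_imp_closed)
      then have "F \<in> sets borel" by auto
      then have "\<bar>measure M1 F - measure M1 E\<bar> < e" "\<bar>measure N1 F - measure N1 E\<bar> < e"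
        "\<bar>measure M2 F - measure M2 E\<bar> < e" "\<bar>measure N2 F - measure N2 E\<bar> < e"
        by (intro F1(3)[rule_format] F2(3)[rule_format] F3(3)[rule_format] F4(3)[rule_format] F; auto simp: F_def)+
      moreover have "4 * e = \<bar>(measure M1 E - measure N1 E) - (measure M2 E - measure N2 E)\<bar>"
        by (simp add: e_def)
      ultimately show False using closed[OF F(1)] by linarith
    qed
  qed
qed

section \<open>Radon measures from contents on clopen sets\<close>

text \<open>A positive, finitely additive content on the clopen sets extends to a Radon measure. Caratheodory's
  extension of the content alone is only sure to reach the sigma-algebra generated by the clopen
  sets, which can be smaller than the Borel sets. The outer measure is therefore built in two
  steps: open sets are measured from inside by clopen sets, and arbitrary sets from outside by
  open sets. Then every open set, being approximated by clopen sets, splits every set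
  additively.\<close>

locale clopen_content =
  fixes m :: "'k::boolean_space set \<Rightarrow> real"
  assumes nonneg: "clopen V \<Longrightarrow> 0 \<le> m V"
    and additive: "clopen V \<Longrightarrow> clopen W \<Longrightarrow> V \<inter> W = {} \<Longrightarrow> m (V \<union> W) = m V + m W"
begin

lemma content_empty: "m {} = 0"
  using additive[of "{}" "{}"] by simp

lemma content_split: "clopen V \<Longrightarrow> clopen W \<Longrightarrow> m V = m (V \<inter> W) + m (V - W)"
  using additive[of "V \<inter> W" "V - W"] by (auto simp: Int_Diff_Un open_Diff closed_Diff)

lemma content_mono: "clopen V \<Longrightarrow> clopen W \<Longrightarrow> V \<subseteq> W \<Longrightarrow> m V \<le> m W"
  using content_split[of W V] nonneg[of "W - V"] by (simp add: open_Diff closed_Diff Int_absorb1)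

definition inner_content :: "'k set \<Rightarrow> ennreal" where
  "inner_content U = (SUP V\<in>{V. clopen V \<and> V \<subseteq> U}. ennreal (m V))"

definition outer_content :: "'k set \<Rightarrow> ennreal" where
  "outer_content E = (INF U\<in>{U. open U \<and> E \<subseteq> U}. inner_content U)"

lemma inner_content_upper: "clopen V \<Longrightarrow> V \<subseteq> U \<Longrightarrow> ennreal (m V) \<le> inner_content U"
  unfolding inner_content_def by (rule SUP_upper) simp

lemma inner_content_least: "(\<And>V. clopen V \<Longrightarrow> V \<subseteq> U \<Longrightarrow> ennreal (m V) \<le> c) \<Longrightarrow> inner_content U \<le> c"
  unfolding inner_content_def by (rule SUP_least) simp

lemma inner_content_add_least:
  assumes "\<And>V. clopen V \<Longrightarrow> V \<subseteq> U \<Longrightarrow> ennreal (m V) + c \<le> d"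
  shows "inner_content U + c \<le> d"
proof -
  have "{V. clopen V \<and> V \<subseteq> U} \<noteq> {}" by (auto intro: exI[of _ "{}"])
  then have "inner_content U + c = (SUP V\<in>{V. clopen V \<and> V \<subseteq> U}. ennreal (m V) + c)"
    unfolding inner_content_def by (rule ennreal_SUP_add_left[symmetric])
  also have "\<dots> \<le> d"
    using assms by (intro SUP_least) simp
  finally show ?thesis .
qed

lemma inner_content_mono: "U \<subseteq> U' \<Longrightarrow> inner_content U \<le> inner_content U'"
  by (rule inner_content_least) (meson inner_content_upper order_trans)

lemma inner_content_clopen: "clopen V \<Longrightarrow> inner_content V = ennreal (m V)"
  by (intro antisym inner_content_least inner_content_upper) (auto intro: ennreal_leI content_mono)

lemma outer_content_lower: "open U \<Longrightarrow> E \<subseteq> U \<Longrightarrow> outer_content E \<le> inner_content U"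
  unfolding outer_content_def by (rule INF_lower) simp

lemma outer_content_greatest: "(\<And>U. open U \<Longrightarrow> E \<subseteq> U \<Longrightarrow> c \<le> inner_content U) \<Longrightarrow> c \<le> outer_content E"
  unfolding outer_content_def by (rule INF_greatest) simp

lemma outer_content_mono: "E \<subseteq> E' \<Longrightarrow> outer_content E \<le> outer_content E'"
  by (rule outer_content_greatest) (meson outer_content_lower order_trans)

lemma outer_content_open: "open U \<Longrightarrow> outer_content U = inner_content U"
  by (intro antisym outer_content_lower outer_content_greatest inner_content_mono) auto

lemma outer_content_finite: "outer_content E < top"
proof -
  have "outer_content E \<le> inner_content UNIV" by (rule outer_content_lower) auto
  also have "\<dots> = ennreal (m UNIV)" by (rule inner_content_clopen) auto
  also have "\<dots> < top" by simp
  finally show ?thesis .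
qed

text \<open>Induction on the number of open sets: the part of \<open>V\<close> outside the first \<open>n\<close> of them is a
  closed subset of the last one, hence it can be cut off inside the last one by a clopen set.\<close>

lemma content_le_sum_inner_content:
  fixes n :: nat
  assumes "\<And>i. open (U i)" "clopen V" "V \<subseteq> (\<Union>i<n. U i)"
  shows "ennreal (m V) \<le> (\<Sum>i<n. inner_content (U i))"
  using assms(2,3)
proof (induction n arbitrary: V)
  case 0
  then show ?case by (simp add: content_empty)
next
  case (Suc n)
  have "closed (V - (\<Union>i<n. U i))"
    using Suc.prems assms(1) by (intro closed_Diff) auto
  moreover have "V - (\<Union>i<n. U i) \<subseteq> U n"
    using Suc.prems by (auto simp: lessThan_Suc)
  ultimately obtain W where W: "clopen W" "V - (\<Union>i<n. U i) \<subseteq> W" "W \<subseteq> U n"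
    using clopen_between[OF _ assms(1)] by metis
  have VW: "clopen (V - W)" "clopen (V \<inter> W)"
    using W Suc.prems by (auto intro: open_Diff closed_Diff)
  have "ennreal (m V) = ennreal (m (V - W)) + ennreal (m (V \<inter> W))"
    using content_split[of V W] W Suc.prems VW nonneg by (simp add: add.commute flip: ennreal_plus)
  also have "\<dots> \<le> (\<Sum>i<n. inner_content (U i)) + inner_content (U n)"
    using W VW by (intro add_mono Suc.IH inner_content_upper) auto
  finally show ?case by simp
qed

text \<open>Compactness of clopen sets turns a countable cover into a finite one; this is what makes a
  merely finitely additive content countably subadditive.\<close>

lemma inner_content_Union:
  fixes U :: "nat \<Rightarrow> 'k set"
  assumes U: "\<And>i. open (U i)"
  shows "inner_content (\<Union>i. U i) \<le> (\<Sum>i. inner_content (U i))"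
proof (rule inner_content_least)
  fix V assume V: "clopen V" "V \<subseteq> (\<Union>i. U i)"
  obtain T where T: "finite T" "V \<subseteq> (\<Union>i\<in>T. U i)"
    using compactE_image[of V UNIV U] V U compact_if_closed by metis
  obtain n where "T \<subseteq> {..<n}" using finite_nat_bounded[OF T(1)] by blast
  then have "V \<subseteq> (\<Union>i<n. U i)" using T(2) by blast
  then have "ennreal (m V) \<le> (\<Sum>i<n. inner_content (U i))"
    using content_le_sum_inner_content U V by blast
  also have "\<dots> \<le> (\<Sum>i. inner_content (U i))" by (rule sum_le_suminf) auto
  finally show "ennreal (m V) \<le> (\<Sum>i. inner_content (U i))" .
qed

lemma outer_content_Union:
  fixes E :: "nat \<Rightarrow> 'k set"
  shows "outer_content (\<Union>i. E i) \<le> (\<Sum>i. outer_content (E i))"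
proof (rule ennreal_le_epsilon)
  fix e :: real assume "0 < e"
  have "\<exists>U. open U \<and> E i \<subseteq> U \<and> inner_content U \<le> outer_content (E i) + e * (1/2) ^ Suc i" for i
  proof -
    have "outer_content (E i) < outer_content (E i) + e * (1/2) ^ Suc i"
      using \<open>0 < e\<close> outer_content_finite[of "E i"] by (cases "outer_content (E i)") auto
    then show ?thesis
      using outer_content_def[of "E i"] by (metis (mono_tags, lifting) INF_less_iff mem_Collect_eq order_less_imp_le)
  qed
  then obtain U where U: "\<And>i. open (U i)" "\<And>i. E i \<subseteq> U i"
    "\<And>i. inner_content (U i) \<le> outer_content (E i) + e * (1/2) ^ Suc i"
    by metis
  have "outer_content (\<Union>i. E i) \<le> inner_content (\<Union>i. U i)"
    using U by (intro outer_content_lower) auto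
  also have "\<dots> \<le> (\<Sum>i. inner_content (U i))" by (rule inner_content_Union[OF U(1)])
  also have "\<dots> \<le> (\<Sum>i. outer_content (E i) + e * (1/2) ^ Suc i)"
    by (intro suminf_le U) auto
  also have "\<dots> = (\<Sum>i. outer_content (E i)) + (\<Sum>i. ennreal e * ennreal ((1/2) ^ Suc i))"
    using \<open>0 < e\<close> by (subst suminf_add[symmetric]) (simp_all only: summableI ennreal_mult less_imp_le zero_le_power zero_le_divide_1_iff zero_le_numeral)
  also have "(\<Sum>i. ennreal e * ennreal ((1/2) ^ Suc i)) = ennreal e"
    unfolding ennreal_suminf_cmult
    by (subst suminf_ennreal_eq[OF zero_le_power power_half_series]) auto
  finally show "outer_content (\<Union>i. E i) \<le> (\<Sum>i. outer_content (E i)) + ennreal e" .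
qed

lemma outer_measure_space_outer_content: "outer_measure_space UNIV outer_content"
proof -
  have "outer_content {} = 0" using outer_content_open[of "{}"] inner_content_clopen[of "{}"] by (simp add: content_empty)
  then show ?thesis
    by (auto simp: outer_measure_space_def positive_def increasing_def countably_subadditive_def
        outer_content_mono outer_content_Union)
qed

lemma outer_content_Un_le: "outer_content (E \<union> E') \<le> outer_content E + outer_content E'"
proof -
  interpret sigma_algebra "UNIV :: 'k set" UNIV
    using sigma_algebra_Pow[of "UNIV :: 'k set"] by simp
  have "subadditive UNIV outer_content"
    using outer_measure_space_outer_content
    by (intro countably_subadditive_subadditive) (auto simp: outer_measure_space_def)
  then have "outer_content (E \<union> (E' - E)) \<le> outer_content E + outer_content (E' - E)"
    unfolding subadditive_def by (metis Diff_disjoint UNIV_I)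
  also have "\<dots> \<le> outer_content E + outer_content E'" by (intro add_mono outer_content_mono) auto
  finally show ?thesis by simp
qed

text \<open>Let \<open>G\<close> be open and contain \<open>E\<close>. If \<open>V\<close> is a clopen subset of \<open>G \<inter> U\<close>, then \<open>G - V\<close> is
  still open and contains \<open>E - U\<close>, and a clopen subset of it can be added to \<open>V\<close> inside \<open>G\<close>.
  Exhausting \<open>G \<inter> U\<close> by such \<open>V\<close> gives the inequality.\<close>

lemma open_in_lambda_system:
  assumes U: "open U"
  shows "U \<in> lambda_system UNIV UNIV outer_content"
proof -
  have "outer_content (U \<inter> E) + outer_content (- U \<inter> E) \<le> outer_content E" for E
  proof (rule outer_content_greatest)
    fix G assume G: "open G" "E \<subseteq> G"
    have add: "ennreal (m V) + outer_content (- U \<inter> E) \<le> inner_content G" if V: "clopen V" "V \<subseteq> G \<inter> U" for V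
    proof -
      have "ennreal (m V) + ennreal (m W) \<le> inner_content G" if W: "clopen W" "W \<subseteq> G - V" for W
      proof -
        have "V \<inter> W = {}" using W(2) by auto
        then have "ennreal (m V) + ennreal (m W) = ennreal (m (V \<union> W))"
          using additive[OF V(1) W(1)] nonneg[OF V(1)] nonneg[OF W(1)] by simp
        also have "\<dots> \<le> inner_content G" using V W by (intro inner_content_upper) auto
        finally show ?thesis .
      qed
      then have "inner_content (G - V) + ennreal (m V) \<le> inner_content G"
        by (intro inner_content_add_least) (simp add: add.commute)
      moreover have "outer_content (- U \<inter> E) \<le> inner_content (G - V)"
        using V G by (intro outer_content_lower) (auto intro: open_Diff)
      ultimately show ?thesis by (metis add.commute add_left_mono order_trans)
    qed
    have "outer_content (U \<inter> E) + outer_content (- U \<inter> E) \<le> inner_content (G \<inter> U) + outer_content (- U \<inter> E)"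
      using G U by (intro add_right_mono outer_content_lower) auto
    also have "\<dots> \<le> inner_content G"
      using add by (rule inner_content_add_least)
    finally show "outer_content (U \<inter> E) + outer_content (- U \<inter> E) \<le> inner_content G" .
  qed
  moreover have "outer_content E \<le> outer_content (U \<inter> E) + outer_content (- U \<inter> E)" for E
    using outer_content_Un_le[of "U \<inter> E" "- U \<inter> E"] by (simp add: Int_Un_distrib2[symmetric])
  ultimately show ?thesis
    by (auto simp: lambda_system_def Compl_eq_Diff_UNIV intro!: antisym)
qed

lemma measure_space_borel_outer_content: "measure_space UNIV (sets borel) outer_content"
proof -
  interpret sigma_algebra "UNIV :: 'k set" UNIV
    using sigma_algebra_Pow[of "UNIV :: 'k set"] by simp
  let ?L = "lambda_system UNIV UNIV outer_content"
  have L: "measure_space UNIV ?L outer_content"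
    by (rule caratheodory_lemma[OF outer_measure_space_outer_content])
  have "{U. open U} \<subseteq> ?L" using open_in_lambda_system by auto
  then have "sets borel \<subseteq> ?L"
    unfolding sets_borel using L by (intro sigma_algebra.sigma_sets_subset) (auto simp: measure_space_def)
  moreover have "sigma_algebra UNIV (sets (borel :: 'k measure))"
    using sets.sigma_algebra_axioms[of "borel :: 'k measure"] by simp
  ultimately show ?thesis
    using L unfolding measure_space_def positive_def countably_additive_def by blast
qed

theorem radon_measure_extending_content:
  obtains M where "radon_measure M" "\<And>V. clopen V \<Longrightarrow> measure M V = m V"
proof -
  define M where "M = measure_of UNIV (sets (borel :: 'k measure)) outer_content"
  have sets: "sets M = sets borel"
    unfolding M_def using sets.sigma_sets_eq[of "borel :: 'k measure"] by (simp add: sets_measure_of)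
  have em: "emeasure M E = outer_content E" if "E \<in> sets borel" for E
    unfolding M_def using measure_space_borel_outer_content that
    by (intro emeasure_measure_of_sigma) (auto simp: measure_space_def)
  have space: "space M = UNIV" by (simp add: M_def space_measure_of_conv)
  interpret finite_measure M
    using outer_content_finite[of UNIV] by (intro finite_measureI) (simp add: space em)
  have "emeasure M E = (SUP F\<in>{F. compact F \<and> F \<subseteq> E}. emeasure M F)" if E: "E \<in> sets borel" for E
  proof (rule antisym)
    show "(SUP F\<in>{F. compact F \<and> F \<subseteq> E}. emeasure M F) \<le> emeasure M E"
      using E sets by (intro SUP_least emeasure_mono) auto
    show "emeasure M E \<le> (SUP F\<in>{F. compact F \<and> F \<subseteq> E}. emeasure M F)"
    proof (rule ennreal_le_epsilon)
      fix e :: real assume "0 < e"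
      have "outer_content (- E) < outer_content (- E) + e"
        using \<open>0 < e\<close> outer_content_finite[of "- E"] by (cases "outer_content (- E)") auto
      then obtain U where U: "open U" "- E \<subseteq> U" "inner_content U < outer_content (- E) + e"
        unfolding outer_content_def[of "- E"] INF_less_iff by auto
      have cU: "emeasure M U < emeasure M (- E) + e"
        using U E by (simp add: em outer_content_open)
      have "measure M E = measure M UNIV - measure M (- E)"
        using finite_measure_compl[of "- E"] E sets space by (simp add: Compl_eq_Diff_UNIV double_diff)
      moreover have "measure M (- U) = measure M UNIV - measure M U"
        using finite_measure_compl[of U] U sets space by (simp add: Compl_eq_Diff_UNIV)
      moreover have "measure M U < measure M (- E) + e"
        using cU \<open>0 < e\<close> by (simp add: emeasure_eq_measure ennreal_less_iff flip: ennreal_plus)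
      ultimately have "measure M E \<le> measure M (- U) + e" by linarith
      then have "emeasure M E \<le> emeasure M (- U) + e"
        using \<open>0 < e\<close> by (simp add: emeasure_eq_measure flip: ennreal_plus)
      also have "emeasure M (- U) \<le> (SUP F\<in>{F. compact F \<and> F \<subseteq> E}. emeasure M F)"
        using U by (intro SUP_upper) (auto intro!: compact_if_closed)
      finally show "emeasure M E \<le> (SUP F\<in>{F. compact F \<and> F \<subseteq> E}. emeasure M F) + e"
        by (simp add: add_right_mono)
    qed
  qed
  then have "radon_measure M"
    using sets finite_measure_axioms by (simp add: radon_measure_def)
  moreover have "measure M V = m V" if "clopen V" for V
    using that nonneg by (simp add: measure_def em outer_content_open inner_content_clopen)
  ultimately show ?thesis by (rule that)
qed

end

section \<open>Clopen step functions\<close>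

definition clopen_indicator :: "'k::topological_space set \<Rightarrow> ('k \<Rightarrow>\<^sub>C real)" where
  "clopen_indicator V = Bcontfun (indicator V)"

lemma apply_clopen_indicator:
  assumes "clopen V"
  shows "apply_bcontfun (clopen_indicator V) = indicator V"
proof -
  have "continuous_on (V \<union> - V) (\<lambda>x. if x \<in> V then 1 else 0 :: real)"
    using assms by (intro continuous_on_If) auto
  then have "continuous_on UNIV (indicator V :: _ \<Rightarrow> real)"
    by (simp add: indicator_def of_bool_def)
  then have "(indicator V :: _ \<Rightarrow> real) \<in> bcontfun"
    by (rule bcontfun_normI[where b = 1]) (simp add: indicator_def)
  then show ?thesis
    by (simp add: clopen_indicator_def Bcontfun_inverse)
qed

lemma norm_clopen_indicator_le: "clopen V \<Longrightarrow> norm (clopen_indicator V) \<le> 1"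
  by (rule norm_bound) (simp add: apply_clopen_indicator indicator_def)

lemma clopen_indicator_Un:
  assumes "clopen V" "clopen W" "V \<inter> W = {}"
  shows "clopen_indicator (V \<union> W) = clopen_indicator V + clopen_indicator W"
proof -
  have "clopen (V \<union> W)" using assms by auto
  then show ?thesis
    using assms by (intro bcontfun_eqI) (auto simp: apply_clopen_indicator indicator_def)
qed

abbreviation clopen_step_functions :: "('k::topological_space \<Rightarrow>\<^sub>C real) set" where
  "clopen_step_functions \<equiv> span (clopen_indicator ` {V. clopen V})"

text \<open>A continuous function is almost constant on small clopen sets, and finitely many of these
  cover the space. The step function is built by adding one clopen set at a time, with the
  constant value placed on the part that is not yet covered.\<close>

lemma clopen_step_functions_dense:
  fixes f :: "'k::boolean_space \<Rightarrow>\<^sub>C real"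
  assumes "e > 0"
  shows "\<exists>g\<in>clopen_step_functions. norm (f - g) \<le> e"
proof -
  let ?\<U> = "{V. clopen V \<and> (\<exists>c. \<forall>y\<in>V. \<bar>apply_bcontfun f y - c\<bar> \<le> e)}"
  have "x \<in> \<Union>?\<U>" for x
  proof -
    let ?U = "apply_bcontfun f -` ball (apply_bcontfun f x) e"
    have "open ?U"
      by (intro open_vimage) auto
    then obtain V where "clopen V" "x \<in> V" "V \<subseteq> ?U"
      using clopen_basis[of ?U x] \<open>e > 0\<close> by auto
    moreover have "\<forall>y\<in>V. \<bar>apply_bcontfun f y - apply_bcontfun f x\<bar> \<le> e"
      using \<open>V \<subseteq> ?U\<close> by (auto simp: dist_real_def)
    ultimately show ?thesis by blast
  qed
  then have "UNIV \<subseteq> \<Union>?\<U>" by blast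
  then obtain T where T: "T \<subseteq> ?\<U>" "finite T" "UNIV \<subseteq> \<Union>T"
    by (rule compactE[OF boolean_space_compact]) auto
  have "\<exists>g\<in>clopen_step_functions. (\<forall>y\<in>\<Union>T. \<bar>apply_bcontfun f y - apply_bcontfun g y\<bar> \<le> e) \<and>
      (\<forall>y. y \<notin> \<Union>T \<longrightarrow> apply_bcontfun g y = 0)"
    using T(2,1)
  proof (induction T)
    case empty
    show ?case by (intro bexI[of _ 0]) (auto simp: span_zero)
  next
    case (insert V T)
    then obtain g where g: "g \<in> clopen_step_functions"
      "\<forall>y\<in>\<Union>T. \<bar>apply_bcontfun f y - apply_bcontfun g y\<bar> \<le> e"
      "\<forall>y. y \<notin> \<Union>T \<longrightarrow> apply_bcontfun g y = 0"
      by auto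
    obtain c where c: "\<forall>y\<in>V. \<bar>apply_bcontfun f y - c\<bar> \<le> e" and V: "clopen V"
      using insert.prems by auto
    have "clopen (\<Union>T)"
      using insert.prems insert.hyps by (auto intro!: closed_Union)
    then have W: "clopen (V - \<Union>T)"
      using V by (auto intro: open_Diff closed_Diff)
    let ?g = "g + c *\<^sub>R clopen_indicator (V - \<Union>T)"
    have g': "apply_bcontfun ?g y = apply_bcontfun g y + c * indicator (V - \<Union>T) y" for y
      by (simp add: apply_clopen_indicator[OF W])
    have "?g \<in> clopen_step_functions"
      using W by (intro span_add[OF g(1)] span_scale span_base) auto
    moreover have "\<bar>apply_bcontfun f y - apply_bcontfun ?g y\<bar> \<le> e" if "y \<in> \<Union>(insert V T)" for y
    proof (cases "y \<in> \<Union>T")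
      case True
      then have "apply_bcontfun ?g y = apply_bcontfun g y"
        unfolding g' by (simp add: indicator_def)
      then show ?thesis using g(2) True by (simp only:)
    next
      case False
      then show ?thesis using that g(3) c unfolding g' by (simp add: indicator_def)
    qed
    moreover have "apply_bcontfun ?g y = 0" if "y \<notin> \<Union>(insert V T)" for y
      using that g(3) unfolding g' by (simp add: indicator_def)
    ultimately show ?case by blast
  qed
  then obtain g where "g \<in> clopen_step_functions"
    "\<forall>y\<in>\<Union>T. \<bar>apply_bcontfun f y - apply_bcontfun g y\<bar> \<le> e" by blast
  then show ?thesis
    using T(3) by (intro bexI[of _ g] norm_bound) auto
qed

lemma bounded_linear_eq_0_if_clopen:
  fixes \<psi> :: "('k::boolean_space \<Rightarrow>\<^sub>C real) \<Rightarrow> real"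
  assumes \<psi>: "bounded_linear \<psi>" and 0: "\<And>V. clopen V \<Longrightarrow> \<psi> (clopen_indicator V) = 0"
  shows "\<psi> f = 0"
proof (rule ccontr)
  interpret bounded_linear \<psi> by (rule \<psi>)
  assume "\<psi> f \<noteq> 0"
  obtain K where K: "0 < K" "\<And>f. norm (\<psi> f) \<le> norm f * K"
    using pos_bounded by blast
  define e where "e = \<bar>\<psi> f\<bar> / (2 * K)"
  have "e > 0" using \<open>\<psi> f \<noteq> 0\<close> K(1) by (simp add: e_def)
  then obtain g where g: "g \<in> clopen_step_functions" "norm (f - g) \<le> e"
    using clopen_step_functions_dense by blast
  have "\<psi> g = 0"
    by (rule linear_eq_0_on_span[OF linear_axioms _ g(1)]) (use 0 in blast)
  then have "\<bar>\<psi> f\<bar> \<le> norm (f - g) * K"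
    using K(2)[of "f - g"] by (simp add: diff)
  also have "\<dots> \<le> e * K" using g(2) K(1) by simp
  also have "\<dots> = \<bar>\<psi> f\<bar> / 2" using K(1) by (simp add: e_def)
  finally show False using \<open>\<psi> f \<noteq> 0\<close> by simp
qed

section \<open>The measure of a functional\<close>

lemma radon_integrable:
  assumes M: "radon_measure M"
  shows "integrable M (apply_bcontfun f :: _ \<Rightarrow> real)"
proof -
  interpret finite_measure M using M by (rule radon_finite)
  have "apply_bcontfun f \<in> borel_measurable M"
    unfolding measurable_cong_sets[OF radon_sets[OF M] refl]
    by (rule borel_measurable_continuous_onI) simp
  then show ?thesis
    by (intro integrable_const_bound[where B = "norm f"] AE_I2 norm_bounded)
qed

lemma radon_bounded_linear_integral:
  assumes M: "radon_measure M"
  shows "bounded_linear (\<lambda>f. integral\<^sup>L M (apply_bcontfun f) :: real)"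
proof (rule bounded_linear_intro[where K = "measure M (space M)"])
  interpret finite_measure M using M by (rule radon_finite)
  fix f g :: "'a \<Rightarrow>\<^sub>C real" and r :: real
  note int = radon_integrable[OF M]
  show "integral\<^sup>L M (apply_bcontfun (f + g)) = integral\<^sup>L M (apply_bcontfun f) + integral\<^sup>L M (apply_bcontfun g)"
    using int by simp
  show "integral\<^sup>L M (apply_bcontfun (r *\<^sub>R f)) = r *\<^sub>R integral\<^sup>L M (apply_bcontfun f)"
    by simp
  have "norm (integral\<^sup>L M (apply_bcontfun f)) \<le> (LINT x|M. norm (apply_bcontfun f x))"
    by (rule integral_norm_bound)
  also have "\<dots> \<le> (LINT x|M. norm f)"
    using int by (intro integral_mono integrable_norm norm_bounded) auto
  finally show "norm (integral\<^sup>L M (apply_bcontfun f)) \<le> norm f * measure M (space M)"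
    by (simp add: mult.commute)
qed

lemma radon_integral_clopen_indicator:
  assumes "radon_measure M" "clopen V"
  shows "integral\<^sup>L M (apply_bcontfun (clopen_indicator V)) = measure M V"
proof -
  have "space M = UNIV" using sets_eq_imp_space_eq[OF radon_sets[OF assms(1)]] by simp
  then show ?thesis using assms(2) by (simp add: apply_clopen_indicator)
qed

text \<open>The Jordan decomposition: \<open>p\<close> is the upper variation of \<open>m\<close>, and \<open>q\<close> is what remains.\<close>

lemma bounded_additive_content_difference:
  fixes m :: "'k::boolean_space set \<Rightarrow> real"
  assumes add: "\<And>V W. clopen V \<Longrightarrow> clopen W \<Longrightarrow> V \<inter> W = {} \<Longrightarrow> m (V \<union> W) = m V + m W"
    and bound: "\<And>V. clopen V \<Longrightarrow> m V \<le> c"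
  obtains p q where "clopen_content p" "clopen_content q" "\<And>V. clopen V \<Longrightarrow> m V = p V - q V"
proof -
  define p where "p V = (SUP W\<in>{W. clopen W \<and> W \<subseteq> V}. m W)" for V
  have bdd: "bdd_above (m ` {W. clopen W \<and> W \<subseteq> V})" for V
    using bound by (auto intro!: bdd_aboveI2)
  have upper: "m W \<le> p V" if "clopen W" "W \<subseteq> V" for V W
    unfolding p_def using that by (intro cSUP_upper bdd) auto
  have least: "p V \<le> b" if "\<And>W. clopen W \<Longrightarrow> W \<subseteq> V \<Longrightarrow> m W \<le> b" for V b
    unfolding p_def using that by (intro cSUP_least) (auto intro: exI[of _ "{}"])
  have "m {} = 0" using add[of "{}" "{}"] by simp
  then have p_nonneg: "0 \<le> p V" for V
    using upper[of "{}" V] by simp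
  have p_add: "p (V \<union> W) = p V + p W" if VW: "clopen V" "clopen W" "V \<inter> W = {}" for V W
  proof (rule antisym)
    show "p (V \<union> W) \<le> p V + p W"
    proof (rule least)
      fix X assume X: "clopen X" "X \<subseteq> V \<union> W"
      then have "X = (X \<inter> V) \<union> (X \<inter> W)" by blast
      then have "m X = m (X \<inter> V) + m (X \<inter> W)"
        using add[of "X \<inter> V" "X \<inter> W"] X VW by (auto simp: disjoint_iff)
      also have "\<dots> \<le> p V + p W"
        using X VW by (intro add_mono upper) auto
      finally show "m X \<le> p V + p W" .
    qed
    have "m X + m Y \<le> p (V \<union> W)" if "clopen X" "X \<subseteq> V" "clopen Y" "Y \<subseteq> W" for X Y
    proof -
      have "X \<inter> Y = {}" using that VW by blast
      then have "m X + m Y = m (X \<union> Y)"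
        using add[of X Y] that by simp
      also have "\<dots> \<le> p (V \<union> W)" using that by (intro upper) auto
      finally show ?thesis .
    qed
    then have "p V \<le> p (V \<union> W) - m Y" if "clopen Y" "Y \<subseteq> W" for Y
      using that by (intro least) (simp add: le_diff_eq)
    then have "p W \<le> p (V \<union> W) - p V"
      by (intro least) (simp add: le_diff_eq add.commute)
    then show "p V + p W \<le> p (V \<union> W)" by simp
  qed
  show ?thesis
  proof
    show "clopen_content p"
      by unfold_locales (use p_nonneg p_add in auto)
    show "clopen_content (\<lambda>V. p V - m V)"
      by unfold_locales (use upper p_add add in auto)
  qed simp
qed

text \<open>The Riesz representation theorem for boolean spaces. The values of \<open>\<phi>\<close> on indicators of
  clopen sets form a bounded additive set function; the contents of its Jordan decomposition
  extend to Radon measures. The functional and the difference of the integrals agree on clopen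
  step functions, hence everywhere by density.\<close>

theorem radon_representation:
  fixes \<phi> :: "('k::boolean_space \<Rightarrow>\<^sub>C real) \<Rightarrow>\<^sub>L real"
  obtains M N where "radon_measure M" "radon_measure N"
    "\<And>f. blinfun_apply \<phi> f = integral\<^sup>L M (apply_bcontfun f) - integral\<^sup>L N (apply_bcontfun f)"
proof -
  define m where "m V = blinfun_apply \<phi> (clopen_indicator V)" for V
  have m_add: "m (V \<union> W) = m V + m W" if "clopen V" "clopen W" "V \<inter> W = {}" for V W
    using that by (simp add: m_def clopen_indicator_Un blinfun.add_right)
  have m_le: "m V \<le> norm \<phi>" if "clopen V" for V
  proof -
    have "norm (m V) \<le> norm \<phi> * norm (clopen_indicator V)"
      unfolding m_def by (rule norm_blinfun)
    also have "\<dots> \<le> norm \<phi> * 1"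
      using norm_clopen_indicator_le[OF that] by (intro mult_left_mono) auto
    finally show ?thesis by simp
  qed
  obtain p q where pq: "clopen_content p" "clopen_content q" "\<And>V. clopen V \<Longrightarrow> m V = p V - q V"
    using bounded_additive_content_difference[of m, OF m_add m_le] by blast
  obtain M where M: "radon_measure M" "\<And>V. clopen V \<Longrightarrow> measure M V = p V"
    using clopen_content.radon_measure_extending_content[OF pq(1)] by blast
  obtain N where N: "radon_measure N" "\<And>V. clopen V \<Longrightarrow> measure N V = q V"
    using clopen_content.radon_measure_extending_content[OF pq(2)] by blast
  have bl: "bounded_linear (\<lambda>f. blinfun_apply \<phi> f -
      (integral\<^sup>L M (apply_bcontfun f) - integral\<^sup>L N (apply_bcontfun f)))"
    by (intro bounded_linear_sub blinfun.bounded_linear_right radon_bounded_linear_integral M N)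
  have "blinfun_apply \<phi> f - (integral\<^sup>L M (apply_bcontfun f) - integral\<^sup>L N (apply_bcontfun f)) = 0" for f
    using bounded_linear_eq_0_if_clopen[OF bl] pq(3) M N
    by (simp add: m_def radon_integral_clopen_indicator)
  then show ?thesis using that[OF M(1) N(1)] by simp
qed

text \<open>The description that defines \<open>riesz_measure\<close> is met by one set function only, because clopen
  sets determine the difference of two Radon measures.\<close>

lemma riesz_measure_eq:
  fixes \<phi> :: "('k::boolean_space \<Rightarrow>\<^sub>C real) \<Rightarrow>\<^sub>L real"
  assumes M: "radon_measure M" and N: "radon_measure N"
    and rep: "\<And>f. blinfun_apply \<phi> f = integral\<^sup>L M (apply_bcontfun f) - integral\<^sup>L N (apply_bcontfun f)"
  shows "riesz_measure \<phi> = (\<lambda>E. measure M E - measure N E)"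
  unfolding riesz_measure_def
proof (rule the_equality)
  show "\<exists>M' N'. radon_measure M' \<and> radon_measure N' \<and>
     (\<forall>f. blinfun_apply \<phi> f = integral\<^sup>L M' (apply_bcontfun f) - integral\<^sup>L N' (apply_bcontfun f)) \<and>
     (\<lambda>E. measure M E - measure N E) = (\<lambda>E. measure M' E - measure N' E)"
    using assms by blast
next
  fix \<mu> assume "\<exists>M' N'. radon_measure M' \<and> radon_measure N' \<and>
     (\<forall>f. blinfun_apply \<phi> f = integral\<^sup>L M' (apply_bcontfun f) - integral\<^sup>L N' (apply_bcontfun f)) \<and>
     \<mu> = (\<lambda>E. measure M' E - measure N' E)"
  then obtain M' N' where M'N': "radon_measure M'" "radon_measure N'"
    and rep': "\<And>f. blinfun_apply \<phi> f = integral\<^sup>L M' (apply_bcontfun f) - integral\<^sup>L N' (apply_bcontfun f)"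
    and \<mu>: "\<mu> = (\<lambda>E. measure M' E - measure N' E)"
    by blast
  have "measure M' V - measure N' V = measure M V - measure N V" if "clopen V" for V
    using rep[of "clopen_indicator V"] rep'[of "clopen_indicator V"] that M N M'N'
    by (simp add: radon_integral_clopen_indicator)
  then show "\<mu> = (\<lambda>E. measure M E - measure N E)"
    unfolding \<mu> using radon_differences_eqI[OF M'N' M N] by blast
qed

text \<open>Regularity of both parts of the measure at once. A clopen set is better than the closed one
  because its indicator is continuous, so that the functional can be evaluated at it.\<close>

lemma riesz_measure_approx_clopen:
  fixes \<phi> :: "('k::boolean_space \<Rightarrow>\<^sub>C real) \<Rightarrow>\<^sub>L real"
  assumes F: "closed F" and U: "open U" "F \<subseteq> U" and "e > 0"
  obtains V where "clopen V" "F \<subseteq> V" "V \<subseteq> U"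
    "\<bar>blinfun_apply \<phi> (clopen_indicator V) - riesz_measure \<phi> F\<bar> < e"
proof -
  obtain M N where M: "radon_measure M" and N: "radon_measure N"
    and rep: "\<And>f. blinfun_apply \<phi> f = integral\<^sup>L M (apply_bcontfun f) - integral\<^sup>L N (apply_bcontfun f)"
    by (rule radon_representation[of \<phi>]) blast
  have e2: "e / 2 > 0" using \<open>e > 0\<close> by simp
  obtain V0 where V0: "clopen V0" "F \<subseteq> V0" "V0 \<subseteq> U"
    using clopen_between[OF F U] by blast
  obtain V1 where V1: "clopen V1" "F \<subseteq> V1"
    "\<forall>X\<in>sets borel. F \<subseteq> X \<longrightarrow> X \<subseteq> V1 \<longrightarrow> \<bar>measure M X - measure M F\<bar> < e / 2"
    using radon_outer_regular[OF M F e2] by blast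
  obtain V2 where V2: "clopen V2" "F \<subseteq> V2"
    "\<forall>X\<in>sets borel. F \<subseteq> X \<longrightarrow> X \<subseteq> V2 \<longrightarrow> \<bar>measure N X - measure N F\<bar> < e / 2"
    using radon_outer_regular[OF N F e2] by blast
  define V where "V = V0 \<inter> V1 \<inter> V2"
  have V: "clopen V" "F \<subseteq> V" "V \<subseteq> U"
    using V0 V1 V2 by (auto simp: V_def)
  have "V \<in> sets borel" using V by auto
  then have "\<bar>measure M V - measure M F\<bar> < e / 2" "\<bar>measure N V - measure N F\<bar> < e / 2"
    using V1(3)[rule_format, of V] V2(3)[rule_format, of V] V by (auto simp: V_def)
  moreover have "blinfun_apply \<phi> (clopen_indicator V) = measure M V - measure N V"
    using rep V M N by (simp add: radon_integral_clopen_indicator)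
  moreover have "riesz_measure \<phi> F = measure M F - measure N F"
    using riesz_measure_eq[OF M N rep] by simp
  ultimately have "\<bar>blinfun_apply \<phi> (clopen_indicator V) - riesz_measure \<phi> F\<bar> < e"
    by linarith
  with V show ?thesis by (rule that)
qed

section \<open>Weakly compact operators and disjoint functions\<close>

lemma closedin_weak_topology:
  fixes \<phi> :: "'x::real_normed_vector \<Rightarrow>\<^sub>L real"
  assumes "closed A"
  shows "closedin weak_topology (blinfun_apply \<phi> -` A)"
proof -
  have op: "openin weak_topology (blinfun_apply \<phi> -` U)" if "open U" for U
    unfolding weak_topology_def using that by (intro topology_generated_by_Basis) blast
  have "topspace (weak_topology :: 'x topology) = UNIV"
    using openin_subset[OF op[OF open_UNIV]] by auto
  moreover have "openin weak_topology (- (blinfun_apply \<phi> -` A))"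
    using op[OF open_Compl[OF assms]] by (simp add: vimage_Compl)
  ultimately show ?thesis by (simp add: closedin_def Compl_eq_Diff_UNIV)
qed

lemma blinfun_apply_point_mass: "blinfun_apply (point_mass y) f = apply_bcontfun f y"
  by transfer simp

lemma compact_sequence_cluster_point:
  fixes x :: "nat \<Rightarrow> 'q::topological_space"
  assumes "compact (UNIV :: 'q set)"
  obtains z where "\<And>U. open U \<Longrightarrow> z \<in> U \<Longrightarrow> \<exists>\<^sub>F k in sequentially. x k \<in> U"
proof (rule ccontr)
  assume "\<not> thesis"
  then have "\<forall>z. \<exists>U. open U \<and> z \<in> U \<and> (\<forall>\<^sub>F k in sequentially. x k \<notin> U)"
    using that unfolding frequently_def by blast
  then obtain U where U: "\<And>z. open (U z)" "\<And>z. z \<in> U z" "\<And>z. \<forall>\<^sub>F k in sequentially. x k \<notin> U z"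
    by metis
  obtain T where T: "finite T" "UNIV \<subseteq> (\<Union>z\<in>T. U z)"
    by (rule compactE_image[OF assms, of UNIV U]) (use U in auto)
  have "\<forall>\<^sub>F k in sequentially. \<forall>z\<in>T. x k \<notin> U z"
    using U(3) by (intro eventually_ball_finite[OF T(1)]) auto
  then have "\<forall>\<^sub>F k in sequentially. False"
    by eventually_elim (use T(2) in blast)
  then show False by simp
qed

text \<open>The double limit argument. By weak compactness the functions \<open>S g\<^sub>n\<close> have a weak
  cluster point \<open>h\<close>, which is again a continuous function, and \<open>\<bar>h\<bar> \<ge> b\<close> at every \<open>y\<^sub>q\<close>.
  At a cluster point \<open>z\<close> of the \<open>y\<^sub>q\<close>, continuity of each \<open>S g\<^sub>n\<close> gives \<open>\<bar>S g\<^sub>n\<bar> \<le> a\<close> and hence \<open>\<bar>h\<bar> \<le> a\<close>, whereas continuity of \<open>h\<close> gives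
  \<open>\<bar>h\<bar> \<ge> b\<close>.\<close>

lemma weakly_compact_no_staircase:
  fixes S :: "('p::topological_space \<Rightarrow>\<^sub>C real) \<Rightarrow>\<^sub>L ('q::topological_space \<Rightarrow>\<^sub>C real)"
    and g :: "nat \<Rightarrow> ('p \<Rightarrow>\<^sub>C real)" and y :: "nat \<Rightarrow> 'q"
  assumes compact: "compact (UNIV :: 'q set)" and S: "weakly_compact_operator S"
    and g: "\<And>n. norm (g n) \<le> 1" and "a < b"
    and ge: "\<And>q n. q < n \<Longrightarrow> b \<le> \<bar>apply_bcontfun (blinfun_apply S (g n)) (y q)\<bar>"
    and le: "\<And>q n. n \<le> q \<Longrightarrow> \<bar>apply_bcontfun (blinfun_apply S (g n)) (y q)\<bar> \<le> a"
  shows False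
proof -
  obtain z where z: "\<And>U. open U \<Longrightarrow> z \<in> U \<Longrightarrow> \<exists>\<^sub>F q in sequentially. y q \<in> U"
    using compact_sequence_cluster_point[OF compact] by blast
  have open_gt: "open {x. r < \<bar>apply_bcontfun h x\<bar>}" and open_lt: "open {x. \<bar>apply_bcontfun h x\<bar> < r}"
    for h :: "'q \<Rightarrow>\<^sub>C real" and r
    by (intro open_Collect_less continuous_intros continuous_on_apply_bcontfun)+
  have le_z: "\<bar>apply_bcontfun (blinfun_apply S (g n)) z\<bar> \<le> a" for n
  proof (rule ccontr)
    assume "\<not> ?thesis"
    then have "\<exists>\<^sub>F q in sequentially. y q \<in> {x. a < \<bar>apply_bcontfun (blinfun_apply S (g n)) x\<bar>}"
      by (intro z open_gt) simp
    moreover have "\<forall>\<^sub>F q in sequentially. y q \<notin> {x. a < \<bar>apply_bcontfun (blinfun_apply S (g n)) x\<bar>}"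
      using eventually_ge_at_top[of n] by eventually_elim (use le in force)
    ultimately show False by (simp add: frequently_def)
  qed
  \<comment> \<open>The cluster point \<open>h\<close> is found by the finite intersection property: these weakly closed conditions
    are met, finitely many at a time, by \<open>S g\<^sub>n\<close> for large \<open>n\<close>.\<close>
  define A where "A q = blinfun_apply (point_mass (y q)) -` {r. b \<le> \<bar>r\<bar>}" for q
  define A' where "A' = blinfun_apply (point_mass z) -` {r. \<bar>r\<bar> \<le> a}"
  let ?W = "weak_topology closure_of (blinfun_apply S ` cball 0 1)"
  have Sg: "blinfun_apply S (g n) \<in> ?W" for n
  proof -
    have "blinfun_apply S ` cball 0 1 \<subseteq> ?W"
      using closedin_weak_topology[of UNIV "0 :: ('q \<Rightarrow>\<^sub>C real) \<Rightarrow>\<^sub>L real"]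
      by (intro closure_of_subset) (auto simp: closedin_def)
    then show ?thesis using g[of n] by auto
  qed
  have "?W \<inter> \<Inter>(insert A' (range A)) \<noteq> {}"
  proof -
    have "closedin weak_topology A'" "closedin weak_topology (A q)" for q
      unfolding A_def A'_def by (intro closedin_weak_topology closed_Collect_le continuous_intros)+
    then have closed: "\<forall>B\<in>insert A' (range A). closedin weak_topology B"
      by blast
    have fip: "?W \<inter> \<Inter>\<F> \<noteq> {}" if \<F>: "finite \<F>" "\<F> \<subseteq> insert A' (range A)" for \<F>
    proof -
      have "finite (\<F> - {A'})" "\<F> - {A'} \<subseteq> range A" using \<F> by auto
      then obtain Q where Q: "finite Q" "\<F> - {A'} = A ` Q"
        by (meson finite_subset_image)
      obtain n where n: "Q \<subseteq> {..<n}" using finite_nat_bounded[OF Q(1)] by blast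
      have "blinfun_apply S (g n) \<in> B" if "B \<in> \<F>" for B
      proof (cases "B = A'")
        case True
        then show ?thesis using le_z by (simp add: A'_def blinfun_apply_point_mass)
      next
        case False
        then have "B \<in> A ` Q" using that by (simp flip: Q(2))
        then obtain q where q: "q \<in> Q" "B = A q" by blast
        then have "q < n" using n by auto
        from ge[OF this] show ?thesis by (simp add: q(2) A_def blinfun_apply_point_mass)
      qed
      with Sg[of n] show ?thesis by blast
    qed
    have "compactin weak_topology ?W"
      using S by (simp add: weakly_compact_operator_def)
    moreover have "\<forall>\<F>. finite \<F> \<and> \<F> \<subseteq> insert A' (range A) \<longrightarrow> ?W \<inter> \<Inter>\<F> \<noteq> {}"
      using fip by simp
    ultimately show ?thesis
      by (rule compactin_fip[THEN iffD1, THEN conjunct2, THEN spec, THEN mp, OF _ conjI[OF closed]])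
  qed
  then obtain h where "h \<in> \<Inter>(insert A' (range A))" by (metis IntE ex_in_conv)
  then have h: "h \<in> A'" "h \<in> A q" for q by simp_all
  have "\<exists>\<^sub>F q in sequentially. y q \<in> {x. \<bar>apply_bcontfun h x\<bar> < b}"
    using h(1) \<open>a < b\<close> by (intro z open_lt) (simp add: A'_def blinfun_apply_point_mass)
  moreover have "y q \<notin> {x. \<bar>apply_bcontfun h x\<bar> < b}" for q
    using h(2)[of q] by (simp add: A_def blinfun_apply_point_mass)
  ultimately show False by simp
qed

text \<open>Along a subsequence the off-diagonal entries of the matrix \<open>a\<^sub>l (x\<^sub>k)\<close> become negligible. Each
  row has a small tail since the absolute sums are bounded, which takes care of late indices
  \<open>l\<close>. For early \<open>l\<close> one moves far along the sequence to an \<open>x\<^sub>k\<close> near a cluster point \<open>z\<close>: if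
  the first few \<open>l\<close> are discarded, then \<open>a\<^sub>l (z)\<close> has a small sum, and by continuity so have
  finitely many of the terms at nearby points.\<close>

lemma gliding_hump:
  fixes a :: "nat \<Rightarrow> 'q::topological_space \<Rightarrow> real"
  assumes compact: "compact (UNIV :: 'q set)"
    and cont: "\<And>l. continuous_on UNIV (a l)"
    and bound: "\<And>x n. (\<Sum>l<n. \<bar>a l x\<bar>) \<le> c"
    and "e > 0"
  obtains r :: "nat \<Rightarrow> nat" where "strict_mono r"
    "\<And>q n. (\<Sum>p\<in>{..<n} - {q}. \<bar>a (r p) (x (r q))\<bar>) \<le> e"
proof -
  obtain z where z: "\<And>U. open U \<Longrightarrow> z \<in> U \<Longrightarrow> \<exists>\<^sub>F k in sequentially. x k \<in> U"
    using compact_sequence_cluster_point[OF compact] by blast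
  have e2: "e / 2 > 0" using \<open>e > 0\<close> by simp
  have tail: "\<exists>N. \<forall>k\<ge>N. \<forall>m. (\<Sum>l=k..m. \<bar>a l y\<bar>) < e / 2" for y
  proof -
    have "summable (\<lambda>l. \<bar>a l y\<bar>)"
      by (rule summableI_nonneg_bounded[where x = c]) (use bound in auto)
    then obtain N where "\<And>k m. N \<le> k \<Longrightarrow> norm (\<Sum>l=k..m. \<bar>a l y\<bar>) < e / 2"
      using summable_partial_sum_bound[OF _ e2] by blast
    then have "(\<Sum>l=k..m. \<bar>a l y\<bar>) < e / 2" if "N \<le> k" for k m
      using that by (smt (verit) real_norm_def)
    then show ?thesis by blast
  qed
  obtain N where N: "\<And>m. (\<Sum>l=N..m. \<bar>a l z\<bar>) < e / 2"
    using tail[of z] by blast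
  have "\<exists>r. \<forall>n. True \<and> (r n < r (Suc n) \<and>
      (\<forall>q\<in>{..r n}. \<forall>m. (\<Sum>l=r (Suc n)..m. \<bar>a l (x q)\<bar>) < e / 2) \<and>
      N \<le> r (Suc n) \<and> (\<Sum>l=N..r n. \<bar>a l (x (r (Suc n)))\<bar>) < e / 2)"
  proof (rule dependent_nat_choice)
    fix k
    have "\<forall>\<^sub>F k' in sequentially. \<forall>q\<in>{..k}. \<forall>m. (\<Sum>l=k'..m. \<bar>a l (x q)\<bar>) < e / 2"
      using tail by (intro eventually_ball_finite) (auto simp: eventually_sequentially)
    moreover have "\<forall>\<^sub>F k' in sequentially. max (Suc k) N \<le> k'"
      by (rule eventually_ge_at_top)
    moreover have "\<exists>\<^sub>F k' in sequentially. x k' \<in> {y. (\<Sum>l=N..k. \<bar>a l y\<bar>) < e / 2}"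
      using N by (intro z open_Collect_less continuous_intros cont) auto
    ultimately have "\<exists>\<^sub>F k' in sequentially.
        (x k' \<in> {y. (\<Sum>l=N..k. \<bar>a l y\<bar>) < e / 2} \<and> max (Suc k) N \<le> k') \<and>
        (\<forall>q\<in>{..k}. \<forall>m. (\<Sum>l=k'..m. \<bar>a l (x q)\<bar>) < e / 2)"
      by (intro frequently_eventually_conj frequently_eventually_frequently)
    from frequently_ex[OF this] obtain k' where
      "x k' \<in> {y. (\<Sum>l=N..k. \<bar>a l y\<bar>) < e / 2}" "max (Suc k) N \<le> k'"
      "\<forall>q\<in>{..k}. \<forall>m. (\<Sum>l=k'..m. \<bar>a l (x q)\<bar>) < e / 2"
      by blast
    then show "\<exists>k'. True \<and> (k < k' \<and> (\<forall>q\<in>{..k}. \<forall>m. (\<Sum>l=k'..m. \<bar>a l (x q)\<bar>) < e / 2) \<and>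
        N \<le> k' \<and> (\<Sum>l=N..k. \<bar>a l (x k')\<bar>) < e / 2)"
      by (intro exI[of _ k']) simp
  qed simp
  then obtain r0 where r0: "\<And>n. r0 n < r0 (Suc n)"
    "\<And>n q m. q \<le> r0 n \<Longrightarrow> (\<Sum>l=r0 (Suc n)..m. \<bar>a l (x q)\<bar>) < e / 2"
    "\<And>n. N \<le> r0 (Suc n)" "\<And>n. (\<Sum>l=N..r0 n. \<bar>a l (x (r0 (Suc n)))\<bar>) < e / 2"
    by auto
  \<comment> \<open>The first index \<open>r0 0\<close> is dropped, since it need not be at least \<open>N\<close>.\<close>
  define r where "r n = r0 (Suc n)" for n
  have mono: "strict_mono r"
    unfolding strict_mono_Suc_iff r_def using r0(1) by blast
  have reindex: "(\<Sum>p\<in>P. \<bar>a (r p) y\<bar>) \<le> (\<Sum>l\<in>L. \<bar>a l y\<bar>)" if "r ` P \<subseteq> L" "finite L" for P L y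
  proof -
    have "(\<Sum>p\<in>P. \<bar>a (r p) y\<bar>) = (\<Sum>l\<in>r ` P. \<bar>a l y\<bar>)"
      using strict_mono_imp_inj_on[OF mono] by (simp add: sum.reindex inj_on_subset)
    also have "\<dots> \<le> (\<Sum>l\<in>L. \<bar>a l y\<bar>)"
      using that by (intro sum_mono2) auto
    finally show ?thesis .
  qed
  have "(\<Sum>p\<in>{..<n} - {q}. \<bar>a (r p) (x (r q))\<bar>) \<le> e" for q n
  proof -
    have "(\<Sum>p\<in>{..<q}. \<bar>a (r p) (x (r q))\<bar>) \<le> (\<Sum>l=N..r0 q. \<bar>a l (x (r q))\<bar>)"
    proof (rule reindex)
      have "r p \<le> r0 q" if "p < q" for p
        using strict_mono_leD[OF mono, of p "q - 1"] that by (simp add: r_def)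
      then show "r ` {..<q} \<subseteq> {N..r0 q}" using r0(3) by (auto simp: r_def)
    qed simp
    moreover have "\<dots> < e / 2" using r0(4)[of q] by (simp add: r_def)
    moreover have "(\<Sum>p\<in>{q<..<n}. \<bar>a (r p) (x (r q))\<bar>) \<le> (\<Sum>l=r (Suc q)..r n. \<bar>a l (x (r q))\<bar>)"
      using strict_mono_leD[OF mono] by (intro reindex) auto
    moreover have "\<dots> < e / 2"
      unfolding r_def by (rule r0(2)) simp
    moreover have "(\<Sum>p\<in>{..<n} - {q}. \<bar>a (r p) (x (r q))\<bar>)
        \<le> (\<Sum>p\<in>{..<q} \<union> {q<..<n}. \<bar>a (r p) (x (r q))\<bar>)"
      by (rule sum_mono2) auto
    moreover have "\<dots> = (\<Sum>p\<in>{..<q}. \<bar>a (r p) (x (r q))\<bar>) + (\<Sum>p\<in>{q<..<n}. \<bar>a (r p) (x (r q))\<bar>)"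
      by (rule sum.union_disjoint) auto
    ultimately show ?thesis by linarith
  qed
  with mono show ?thesis by (rule that)
qed

lemma apply_bcontfun_sum:
  "apply_bcontfun (\<Sum>i\<in>I. f i) x = (\<Sum>i\<in>I. apply_bcontfun (f i) x :: real)"
  by (induction I rule: infinite_finite_induct) auto

text \<open>At each point at most one summand is different from \<open>0\<close>.\<close>

lemma norm_disjoint_sum_le:
  fixes f :: "'i \<Rightarrow> ('p::topological_space \<Rightarrow>\<^sub>C real)"
  assumes disjoint: "\<And>k l x. k \<noteq> l \<Longrightarrow> apply_bcontfun (f k) x = 0 \<or> apply_bcontfun (f l) x = 0"
    and norm: "\<And>k. norm (f k) \<le> 1" and c: "\<And>k. \<bar>c k\<bar> \<le> 1"
  shows "norm (\<Sum>k\<in>I. c k *\<^sub>R f k) \<le> 1"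
proof (cases "finite I")
  case True
  show ?thesis
  proof (rule norm_bound)
    fix x
    have eq: "apply_bcontfun (\<Sum>k\<in>I. c k *\<^sub>R f k) x = (\<Sum>k\<in>I. c k * apply_bcontfun (f k) x)"
      by (simp add: apply_bcontfun_sum)
    show "norm (apply_bcontfun (\<Sum>k\<in>I. c k *\<^sub>R f k) x) \<le> 1"
    proof (cases "\<exists>l\<in>I. apply_bcontfun (f l) x \<noteq> 0")
      case True
      then obtain l where l: "l \<in> I" "apply_bcontfun (f l) x \<noteq> 0" by blast
      have "(\<Sum>k\<in>I. c k * apply_bcontfun (f k) x) = (\<Sum>k\<in>{l}. c k * apply_bcontfun (f k) x)"
        using l disjoint by (intro sum.mono_neutral_right \<open>finite I\<close>) fastforce+
      moreover have "\<bar>apply_bcontfun (f l) x\<bar> \<le> 1"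
        using norm_bounded[of "f l" x] norm[of l] by simp
      ultimately show ?thesis
        unfolding eq using c[of l] by (simp add: abs_mult mult_le_one)
    next
      case False
      then have "(\<Sum>k\<in>I. c k * apply_bcontfun (f k) x) = 0"
        by (intro sum.neutral) auto
      then show ?thesis unfolding eq by simp
    qed
  qed
qed simp

text \<open>With the signs of \<open>S f\<^sub>k (y)\<close> as coefficients, the sum is the value at \<open>y\<close> of \<open>S\<close> applied to
  a function in the unit ball.\<close>

lemma sum_abs_disjoint_le:
  fixes S :: "('p::topological_space \<Rightarrow>\<^sub>C real) \<Rightarrow>\<^sub>L ('q::topological_space \<Rightarrow>\<^sub>C real)"
  assumes disjoint: "\<And>k l x. k \<noteq> l \<Longrightarrow> apply_bcontfun (f k) x = 0 \<or> apply_bcontfun (f l) x = 0"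
    and norm: "\<And>k. norm (f k) \<le> 1"
  shows "(\<Sum>k\<in>I. \<bar>apply_bcontfun (blinfun_apply S (f k)) y\<bar>) \<le> norm S"
proof -
  let ?c = "\<lambda>k. sgn (apply_bcontfun (blinfun_apply S (f k)) y)"
  let ?g = "\<Sum>k\<in>I. ?c k *\<^sub>R f k"
  have "(\<Sum>k\<in>I. \<bar>apply_bcontfun (blinfun_apply S (f k)) y\<bar>) = apply_bcontfun (blinfun_apply S ?g) y"
    by (simp add: blinfun.sum_right blinfun.scaleR_right apply_bcontfun_sum abs_sgn mult.commute)
  also have "\<dots> \<le> norm (apply_bcontfun (blinfun_apply S ?g) y)" by simp
  also have "\<dots> \<le> norm (blinfun_apply S ?g)" by (rule norm_bounded)
  also have "\<dots> \<le> norm S * norm ?g" by (rule norm_blinfun)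
  also have "\<dots> \<le> norm S * 1"
    by (intro mult_left_mono norm_disjoint_sum_le disjoint norm) (auto simp: sgn_if)
  finally show ?thesis by simp
qed

text \<open>Otherwise there are points \<open>x\<^sub>k\<close> at which \<open>\<bar>S f\<^sub>k\<bar>\<close> stays away from \<open>0\<close>, along a subsequence.
  After the gliding hump the partial sums \<open>g\<^sub>n\<close> of the \<open>f\<^sub>k\<close> form a staircase: \<open>S g\<^sub>n\<close> is large at the
  points whose own summand is already included and small at all later ones. Since the
  \<open>f\<^sub>k\<close> are disjoint, the partial sums lie in the unit ball, and the staircase contradicts
  \<open>weakly_compact_no_staircase\<close>.\<close>

theorem weakly_compact_disjoint_tendsto_0:
  fixes S :: "('p::topological_space \<Rightarrow>\<^sub>C real) \<Rightarrow>\<^sub>L ('q::topological_space \<Rightarrow>\<^sub>C real)"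
  assumes compact: "compact (UNIV :: 'q set)" and S: "weakly_compact_operator S"
    and disjoint: "\<And>k l x. k \<noteq> l \<Longrightarrow> apply_bcontfun (f k) x = 0 \<or> apply_bcontfun (f l) x = 0"
    and norm: "\<And>k. norm (f k) \<le> 1"
  shows "(\<lambda>k::nat. norm (blinfun_apply S (f k))) \<longlonglongrightarrow> 0"
proof (rule ccontr)
  assume "\<not> ?thesis"
  then obtain d where d: "d > 0" "\<exists>\<^sub>F k in sequentially. d \<le> norm (blinfun_apply S (f k))"
    unfolding tendsto_iff by (auto simp: not_eventually not_less)
  then obtain s :: "nat \<Rightarrow> nat" where s: "strict_mono s" "\<And>k. d \<le> norm (blinfun_apply S (f (s k)))"
    using infinite_enumerate[of "{k. d \<le> norm (blinfun_apply S (f k))}"]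
    by (auto simp: frequently_cofinite[symmetric] cofinite_eq_sequentially)
  define a where "a k x = apply_bcontfun (blinfun_apply S (f (s k))) x" for k x
  have s_ne: "s k \<noteq> s l" if "k \<noteq> l" for k l
    using that strict_mono_eq[OF s(1)] by simp
  note disjoint_s = disjoint[OF s_ne]
  have "\<exists>x. d / 2 < \<bar>a k x\<bar>" for k
  proof (rule ccontr)
    assume "\<nexists>x. d / 2 < \<bar>a k x\<bar>"
    then have "norm (blinfun_apply S (f (s k))) \<le> d / 2"
      by (intro norm_bound) (auto simp: a_def not_less)
    with s(2)[of k] d(1) show False by simp
  qed
  then obtain x where x: "\<And>k. d / 2 < \<bar>a k (x k)\<bar>" by metis
  have cont: "continuous_on UNIV (a l)" for l
    unfolding a_def by simp
  have bound: "(\<Sum>l<n. \<bar>a l y\<bar>) \<le> norm S" for y n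
    unfolding a_def by (rule sum_abs_disjoint_le[OF disjoint_s norm])
  have "d / 8 > 0" using d(1) by simp
  then obtain r :: "nat \<Rightarrow> nat" where r: "strict_mono r"
    "\<And>q n. (\<Sum>p\<in>{..<n} - {q}. \<bar>a (r p) (x (r q))\<bar>) \<le> d / 8"
    by (rule gliding_hump[of a "norm S" "d / 8" x, OF compact cont bound]) (rule that)
  have r_ne: "r k \<noteq> r l" if "k \<noteq> l" for k l
    using that strict_mono_eq[OF r(1)] by simp
  define g where "g n = (\<Sum>p<n. f (s (r p)))" for n
  have Sg: "apply_bcontfun (blinfun_apply S (g n)) y = (\<Sum>p<n. a (r p) y)" for n y
    by (simp add: g_def a_def blinfun.sum_right apply_bcontfun_sum)
  have rest: "\<bar>\<Sum>p\<in>{..<n} - {q}. a (r p) (x (r q))\<bar> \<le> d / 8" for q n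
    by (rule order_trans[OF sum_abs r(2)])
  show False
  proof (rule weakly_compact_no_staircase[OF compact S])
    show "norm (g n) \<le> 1" for n
      using norm_disjoint_sum_le[of "\<lambda>p. f (s (r p))" "\<lambda>_. 1" "{..<n}"] disjoint_s[OF r_ne] norm
      by (simp add: g_def)
    show "d / 8 < d / 4" using d(1) by simp
    show "\<bar>apply_bcontfun (blinfun_apply S (g n)) (x (r q))\<bar> \<le> d / 8" if "n \<le> q" for n q
      using rest[where q = q and n = n] that unfolding Sg by simp
    show "d / 4 \<le> \<bar>apply_bcontfun (blinfun_apply S (g n)) (x (r q))\<bar>" if "q < n" for n q
    proof -
      have "(\<Sum>p<n. a (r p) (x (r q)))
          = a (r q) (x (r q)) + (\<Sum>p\<in>{..<n} - {q}. a (r p) (x (r q)))"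
        using that by (intro sum.remove) auto
      then show ?thesis
        unfolding Sg using rest[where q = q and n = n] x[of "r q"] d(1) by linarith
    qed
  qed
qed

section \<open>Ultrafilters of a subalgebra and fibres\<close>

lemma ultrafilters_subset: "u \<in> ultrafilters D \<Longrightarrow> a \<in> u \<Longrightarrow> a \<in> D"
  and ultrafilters_inf: "u \<in> ultrafilters D \<Longrightarrow> a \<in> u \<Longrightarrow> b \<in> u \<Longrightarrow> inf a b \<in> u"
  and ultrafilters_uminus: "u \<in> ultrafilters D \<Longrightarrow> a \<in> D \<Longrightarrow> a \<in> u \<or> - a \<in> u"
  by (auto simp: ultrafilters_def)

text \<open>The point-free form of the fact that an infinite set in a zero-dimensional Hausdorff space
  contains a sequence with pairwise disjoint clopen neighbourhoods. While infinitely many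
  ultrafilters contain \<open>d\<close>, two of them are separated by some \<open>e\<close>. One of the two halves of \<open>d\<close>
  cut out by \<open>e\<close> still belongs to infinitely many of them and becomes the next \<open>d\<close>; the other
  half belongs to at least one and becomes the next \<open>c\<close>.\<close>

lemma infinite_ultrafilters_disjoint_members:
  fixes D :: "'a::boolean_algebra set"
  assumes D: "boolean_subalgebra D" and G: "G \<subseteq> ultrafilters D" "infinite G"
  obtains t :: "nat \<Rightarrow> 'a set" and c :: "nat \<Rightarrow> 'a" where "\<And>k. t k \<in> G" "\<And>k. c k \<in> t k"
    "\<And>k l. k \<noteq> l \<Longrightarrow> inf (c k) (c l) = bot"
proof -
  let ?big = "\<lambda>d. d \<in> D \<and> infinite {u \<in> G. d \<in> u}"
  let ?step = "\<lambda>d d' t c. d' \<le> d \<and> t \<in> G \<and> c \<in> t \<and> c \<le> d \<and> inf c d' = bot"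
  have step: "\<exists>d' t c. ?big d' \<and> ?step d d' t c" if d: "?big d" for d
  proof -
    have "\<exists>u v. u \<in> G \<and> d \<in> u \<and> v \<in> G \<and> d \<in> v \<and> u \<noteq> v"
    proof (rule ccontr)
      assume contra: "\<not> ?thesis"
      obtain u where "u \<in> {u \<in> G. d \<in> u}" using d by (metis finite.emptyI equals0I)
      then have "{u \<in> G. d \<in> u} \<subseteq> {u}" using contra by blast
      then show False using d finite_subset by blast
    qed
    then obtain u v where "u \<in> G" "d \<in> u" "v \<in> G" "d \<in> v" "u \<noteq> v" by blast
    then obtain u v e where uv: "u \<in> G" "d \<in> u" "v \<in> G" "d \<in> v" and e: "e \<in> u" "e \<notin> v"
      by blast
    have U: "u \<in> ultrafilters D" "v \<in> ultrafilters D" using uv G by auto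
    have eD: "e \<in> D" using ultrafilters_subset[OF U(1) e(1)] .
    have D': "inf d e \<in> D" "inf d (- e) \<in> D"
      using d eD D by (auto simp: boolean_subalgebra_def)
    have mem: "inf d e \<in> u" "inf d (- e) \<in> v"
      using ultrafilters_inf U uv e ultrafilters_uminus[OF U(2) eD] by blast+
    have "{u \<in> G. d \<in> u} \<subseteq> {u \<in> G. inf d e \<in> u} \<union> {u \<in> G. inf d (- e) \<in> u}"
      using G(1) ultrafilters_inf ultrafilters_uminus[OF _ eD] by blast
    then have "infinite {u \<in> G. inf d e \<in> u} \<or> infinite {u \<in> G. inf d (- e) \<in> u}"
      using d by (meson finite_Un finite_subset)
    moreover have "inf (inf d e) (inf d (- e)) = bot"
      by (simp add: inf.assoc inf.left_commute)
    then have "?step d (inf d e) v (inf d (- e))" "?step d (inf d (- e)) u (inf d e)"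
      using uv mem by (simp_all add: inf.commute)
    ultimately show ?thesis using D' by blast
  qed
  have "\<exists>s. \<forall>n. ?big (fst (s n)) \<and>
      ?step (fst (s n)) (fst (s (Suc n))) (fst (snd (s (Suc n)))) (snd (snd (s (Suc n))))"
  proof (rule dependent_nat_choice)
    have "{u \<in> G. top \<in> u} = G" using G(1) by (auto simp: ultrafilters_def)
    then show "\<exists>x. ?big (fst x)"
      using D G(2) by (intro exI[of _ "(top, undefined)"]) (simp add: boolean_subalgebra_def)
  next
    fix x :: "'a \<times> 'a set \<times> 'a" assume "?big (fst x)"
    from step[OF this] obtain d' t c where "?big d'" "?step (fst x) d' t c" by blast
    then show "\<exists>y. ?big (fst y) \<and> ?step (fst x) (fst y) (fst (snd y)) (snd (snd y))"
      by (intro exI[of _ "(d', t, c)"]) simp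
  qed
  then obtain s :: "nat \<Rightarrow> 'a \<times> 'a set \<times> 'a" where
    s: "\<And>n. ?step (fst (s n)) (fst (s (Suc n))) (fst (snd (s (Suc n)))) (snd (snd (s (Suc n))))"
    by blast
  \<comment> \<open>Component \<open>n + 1\<close> holds what was split off from \<open>d n\<close>; the last two entries of \<open>s 0\<close> are
    arbitrary.\<close>
  define d where "d n = fst (s n)" for n
  define t where "t n = fst (snd (s (Suc n)))" for n
  define c where "c n = snd (snd (s (Suc n)))" for n
  have st: "d (Suc n) \<le> d n" "t n \<in> G" "c n \<in> t n" "c n \<le> d n" "inf (c n) (d (Suc n)) = bot" for n
    using s[of n] by (simp_all add: d_def t_def c_def)
  have "decseq d" using st(1) by (simp add: decseq_Suc_iff)
  have less: "inf (c k) (c l) = bot" if "k < l" for k l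
  proof -
    have "c l \<le> d (Suc k)"
      using st(4)[of l] decseqD[OF \<open>decseq d\<close>, of "Suc k" l] that by (meson Suc_leI order_trans)
    then have "inf (c k) (c l) \<le> inf (c k) (d (Suc k))" by (rule inf_mono[OF order_refl])
    then show ?thesis using st(5)[of k] by (simp add: bot_unique)
  qed
  have "inf (c k) (c l) = bot" if "k \<noteq> l" for k l
    using less[of k l] less[of l k] that by (metis inf.commute linorder_neqE_nat)
  then show ?thesis using st(2,3) that by blast
qed

lemma boolean_subalgebra_fixed_points:
  assumes B: "boolean_subalgebra B" and \<sigma>: "boolean_automorphism B \<sigma>"
  shows "boolean_subalgebra {b \<in> B. \<sigma> b = b}"
proof -
  have botB: "bot \<in> B" and topB: "top \<in> B" using B by (auto simp: boolean_subalgebra_def)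
  have \<sigma>_compl: "\<sigma> (- a) = - \<sigma> a" if "a \<in> B" for a
    using \<sigma> that by (simp add: boolean_automorphism_def)
  have "\<sigma> (inf bot top) = inf (\<sigma> bot) (\<sigma> top)"
    using \<sigma> botB topB unfolding boolean_automorphism_def by blast
  also have "\<sigma> top = - \<sigma> bot"
    using \<sigma>_compl[OF botB] by simp
  finally have bot: "\<sigma> bot = bot" by simp
  then have "\<sigma> top = top" using \<sigma>_compl[OF botB] by simp
  with bot show ?thesis
    using B \<sigma> by (auto simp: boolean_subalgebra_def boolean_automorphism_def)
qed

text \<open>An ultrafilter restricts to \<open>t\<close> if and only if each \<open>c\<close> in the subalgebra decides it as \<open>t\<close>
  does, so the fibre is an intersection of clopen sets.\<close>

lemma closed_tau_copy_fibre:
  fixes t :: "('n, 'a::{boolean_algebra, infinite} set) phantom"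
  assumes "t \<in> L_copy C"
  shows "closed (tau_copy C -` {t} :: ('n, 'a stone) phantom set)"
proof -
  have t: "of_phantom t \<in> ultrafilters C"
    using assms by (auto simp: L_copy_def)
  have "tau_copy C x = t \<longleftrightarrow> (\<forall>c\<in>C. of_phantom x \<in> (if c \<in> of_phantom t then clopen_of c else - clopen_of c))"
    for x :: "('n, 'a stone) phantom"
  proof -
    have "tau_copy C x = t \<longleftrightarrow> ultra_of (of_phantom x) \<inter> C = of_phantom t"
      by (auto simp: tau_copy_def tau_def)
    also have "\<dots> \<longleftrightarrow> (\<forall>c\<in>C. c \<in> ultra_of (of_phantom x) \<longleftrightarrow> c \<in> of_phantom t)"
      using ultrafilters_subset[OF t] by blast
    also have "\<dots> \<longleftrightarrow> (\<forall>c\<in>C. of_phantom x \<in> (if c \<in> of_phantom t then clopen_of c else - clopen_of c))"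
      by (auto simp: clopen_of_def)
    finally show ?thesis .
  qed
  then have "tau_copy C -` {t} =
      (\<Inter>c\<in>C. of_phantom -` (if c \<in> of_phantom t then clopen_of c else - clopen_of c))"
    by (intro set_eqI) (simp only: vimage_eq singleton_iff INT_iff)
  also have "closed \<dots>"
    using clopen_clopen_of by (intro closed_INT ballI closed_of_phantom_vimage) auto
  finally show ?thesis .
qed

theorem lemma6p2:
  fixes k1 k2 :: "'a::{boolean_algebra, infinite}"
    and B C :: "'a set"
    and \<sigma> :: "'a \<Rightarrow> 'a"
    and S :: "(('n, 'a stone) phantom \<Rightarrow>\<^sub>C real) \<Rightarrow>\<^sub>L (('m, 'a stone) phantom \<Rightarrow>\<^sub>C real)"
    and j :: nat
  assumes K_union: "clopen_of k1 \<union> clopen_of k2 = UNIV"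
    and K_disjoint: "clopen_of k1 \<inter> clopen_of k2 = {}"
    and K_separable: "separable_space (euclidean :: 'a stone topology)"
    and K_perfect: "\<forall>x::'a stone. \<not> open {x}"
    and few_operators: "\<forall>T :: ('a stone \<Rightarrow>\<^sub>C real) \<Rightarrow>\<^sub>L ('a stone \<Rightarrow>\<^sub>C real).
        \<exists>(f :: 'a stone \<Rightarrow>\<^sub>C real) (W :: ('a stone \<Rightarrow>\<^sub>C real) \<Rightarrow>\<^sub>L ('a stone \<Rightarrow>\<^sub>C real)).
          weakly_compact_operator W \<and>
          (\<forall>g x. apply_bcontfun (blinfun_apply T g) x
                   = apply_bcontfun f x * apply_bcontfun g x + apply_bcontfun (blinfun_apply W g) x)"
    and no_l_infinity: "\<nexists>J :: (nat \<Rightarrow>\<^sub>C real) \<Rightarrow>\<^sub>L ('a stone \<Rightarrow>\<^sub>C real). isomorphic_embedding J"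
    and B_dense: "dense_subalgebra B"
    and k_in_B: "k1 \<in> B" "k2 \<in> B"
    and \<sigma>_aut: "boolean_automorphism B \<sigma>"
    and \<sigma>_swap: "\<sigma> k2 = k1" "\<sigma> k1 = k2"
    and \<sigma>_involution: "\<forall>b\<in>B. \<sigma> (\<sigma> b) = b"
    and subsequential_sups: "\<forall>a :: nat \<Rightarrow> 'a. (\<forall>p q. p \<noteq> q \<longrightarrow> inf (a p) (a q) = bot) \<longrightarrow>
        (\<exists>M. infinite M \<and> (\<exists>s. (\<forall>p\<in>M. a p \<le> s) \<and> (\<forall>u. (\<forall>p\<in>M. a p \<le> u) \<longrightarrow> s \<le> u)))"
    and C_def: "C = {b \<in> B. \<sigma> b = b}"
    and S_weakly_compact: "weakly_compact_operator S"
    and j_pos: "j \<ge> 1"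
  shows "finite (Gamma_set C S j)"
proof (rule ccontr)
  assume inf: "infinite (Gamma_set C S j)"
  have C: "boolean_subalgebra C"
    using B_dense \<sigma>_aut boolean_subalgebra_fixed_points
    by (auto simp: C_def dense_subalgebra_def)
  have "inj_on of_phantom (Gamma_set C S j)"
    by (rule inj_onI) (metis phantom.collapse)
  then have "infinite (of_phantom ` Gamma_set C S j)"
    using inf by (simp add: finite_image_iff)
  moreover have "of_phantom ` Gamma_set C S j \<subseteq> ultrafilters C"
    by (auto simp: Gamma_set_def L_copy_def)
  ultimately obtain t c where t: "\<And>k::nat. t k \<in> of_phantom ` Gamma_set C S j"
    and c: "\<And>k. c k \<in> t k" "\<And>k l. k \<noteq> l \<Longrightarrow> inf (c k) (c l) = bot"
    using infinite_ultrafilters_disjoint_members[OF C] by blast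
  define U :: "nat \<Rightarrow> ('n, 'a stone) phantom set" where "U k = of_phantom -` clopen_of (c k)" for k
  have U_disjoint: "U k \<inter> U l = {}" if "k \<noteq> l" for k l
    unfolding U_def vimage_Int[symmetric] clopen_of_inf[symmetric] c(2)[OF that] by simp
  have "\<exists>V x. clopen V \<and> V \<subseteq> U k \<and>
      1 / real j < \<bar>apply_bcontfun (blinfun_apply S (clopen_indicator V)) x\<bar>" for k
  proof -
    obtain T where T: "T \<in> Gamma_set C S j" "of_phantom T = t k" using t[of k] by blast
    let ?F = "tau_copy C -` {T} :: ('n, 'a stone) phantom set"
    obtain x :: "('n, 'a stone) phantom" where
      x: "1 / real j < \<bar>riesz_measure (adjoint_operator S (point_mass (copy_map x))) ?F\<bar>"
      using T(1) unfolding Gamma_set_def by blast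
    let ?\<phi> = "adjoint_operator S (point_mass (copy_map x))"
    have F: "closed ?F" using T(1) by (intro closed_tau_copy_fibre) (simp add: Gamma_set_def)
    have open_U: "open (U k)" unfolding U_def using clopen_clopen_of by (intro open_of_phantom_vimage) auto
    have FU: "?F \<subseteq> U k"
      using c(1)[of k] T(2) by (auto simp: U_def tau_copy_def tau_def clopen_of_def)
    \<comment> \<open>The approximation is finer than the amount by which the measure of the fibre exceeds
      the bound, so the clopen set exceeds it as well.\<close>
    have margin: "\<bar>riesz_measure ?\<phi> ?F\<bar> - 1 / real j > 0" using x by simp
    obtain V where V: "clopen V" "?F \<subseteq> V" "V \<subseteq> U k"
      "\<bar>blinfun_apply ?\<phi> (clopen_indicator V) - riesz_measure ?\<phi> ?F\<bar> < \<bar>riesz_measure ?\<phi> ?F\<bar> - 1 / real j"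
      by (rule riesz_measure_approx_clopen[OF F open_U FU margin, of ?\<phi>]) (rule that)
    then have "1 / real j < \<bar>blinfun_apply ?\<phi> (clopen_indicator V)\<bar>" by linarith
    then show ?thesis
      using V(1,3) by (auto simp: adjoint_operator_def blinfun_apply_point_mass)
  qed
  then obtain V x where V: "\<And>k. clopen (V k)" "\<And>k. V k \<subseteq> U k"
    and big: "\<And>k. 1 / real j < \<bar>apply_bcontfun (blinfun_apply S (clopen_indicator (V k))) (x k)\<bar>"
    by metis
  have "(\<lambda>k. norm (blinfun_apply S (clopen_indicator (V k)))) \<longlonglongrightarrow> 0"
  proof (rule weakly_compact_disjoint_tendsto_0[OF boolean_space_compact S_weakly_compact])
    show "apply_bcontfun (clopen_indicator (V k)) y = 0 \<or> apply_bcontfun (clopen_indicator (V l)) y = 0"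
      if "k \<noteq> l" for k l y
      using U_disjoint[OF that] V(2)[of k] V(2)[of l] V(1)
      by (auto simp: apply_clopen_indicator indicator_def)
    show "norm (clopen_indicator (V k)) \<le> 1" for k
      using V(1) by (rule norm_clopen_indicator_le)
  qed
  moreover have "1 / real j > 0" using j_pos by simp
  ultimately have "\<forall>\<^sub>F k in sequentially. norm (blinfun_apply S (clopen_indicator (V k))) < 1 / real j"
    by (rule order_tendstoD(2))
  then obtain k where "norm (blinfun_apply S (clopen_indicator (V k))) < 1 / real j"
    by (auto dest: eventually_happens)
  then show False
    using big[of k] norm_bounded[of "blinfun_apply S (clopen_indicator (V k))" "x k"] by simp
qed

end
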